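(* Let $q$ be a power of an odd prime, let $n\ge3$ be odd, and let $f\in\mathbb{F}_q[x_1,\dots,x_n]$ be a non-degenerate quadratic form. Let $X=V(f)\subseteq\mathbb{P}^{n-1}$. Then for every integer $P\ge1$: if $n=3$, $$\#\mathrm{Mor}_P(\mathbb{P}^1,X)(\mathbb{F}_q)=\begin{cases}\frac{q^2-1}{q}\,q^{P}&\text{if }2\mid P,\\0&\text{if }2\nmid P,\end{cases}$$ and if $n\ge5$, $$\#\mathrm{Mor}_P(\mathbb{P}^1,X)(\mathbb{F}_q)=\begin{cases}\frac{(q^{n-1}-1)(q^{n-2}-1)}{q^{n-2}(q-1)}\,q^{P(n-2)}&\text{if }2\mid P,\\ \frac{(q^{n-1}-1)(q^{n-2}-1)}{q^{n-2}(q-1)}\,q^{P(n-2)}-\frac{q^{n-1}-1}{q^{(n-1)/2}}\,q^{\frac{n-1}{2}P}&\text{if }2\nmid P.\end{cases}$$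
   Context: Non-degenerate means the symmetric matrix $A$ with $f(\mathbf{x})=\mathbf{x}^TA\mathbf{x}$ has nonzero determinant. $\#\mathrm{Mor}_P(\mathbb{P}^1,X)(\mathbb{F}_q)$ denotes the number of morphisms $\mathbb{P}^1\to X$ of degree exactly $P$ defined over $\mathbb{F}_q$; equivalently, it is the number of vectors $(x_1,\dots,x_n)\in\mathbb{F}_q[t]^n$ with $\gcd(x_1,\dots,x_n)=1$, $\max_i\deg(x_i)=P$ and $f(x_1,\dots,x_n)=0$, counted modulo multiplication by scalars in $\mathbb{F}_q^\times$ (i.e. this number divided by $q-1$). *)

theory Defs
  imports "HOL-Analysis.Analysis" "HOL-Computational_Algebra.Polynomial_Factorial"
begin

definition qf_eval :: "'a::comm_ring_1^'n^'n \<Rightarrow> 'a poly^'n \<Rightarrow> 'a poly" where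
  "qf_eval A x = (\<Sum>i\<in>UNIV. \<Sum>j\<in>UNIV. smult (A$i$j) (x$i * x$j))"

definition mor_vectors :: "'a::{finite,field_gcd}^'n^'n \<Rightarrow> nat \<Rightarrow> ('a poly^'n) set" where
  "mor_vectors A P = {x. Gcd (range (\<lambda>i. x$i)) = 1 \<and>
                         Max (range (\<lambda>i. degree (x$i))) = P \<and>
                         qf_eval A x = 0}"

text \<open>Number of degree-P morphisms P^1 -> V(f) over F_q: the above count modulo F_q^*.\<close>
definition num_mor :: "'a::{finite,field_gcd}^'n^'n \<Rightarrow> nat \<Rightarrow> real" where
  "num_mor A P = real (card (mor_vectors A P)) / (real CARD('a) - 1)"

end

theory Submission
  imports Defs "HOL-Computational_Algebra.Squarefree"
begin

text \<open>
  Over \<open>F\<^sub>q\<close> a nondegenerate form in \<open>n = 2m + 1\<close> variables is equivalent to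
  \<open>x\<^sub>1 y\<^sub>1 + \<dots> + x\<^sub>m y\<^sub>m + a z\<^sup>2\<close>. Let \<open>x\<close> be a zero over the polynomial ring with all entries of degree
  at most \<open>P\<close>, and suppose its vector of coefficients at \<open>t\<^sup>P\<close> is nonzero. Some hyperbolic coordinate then
  has degree \<open>P\<close>, say it is \<open>u Q\<close> with \<open>Q\<close> monic. Modulo \<open>Q\<close> the other coordinates become a zero of the form
  in \<open>n - 2\<close> variables, and the partner coordinate is determined by the equation. So every nonzero isotropic
  vector of constants is the leading vector of equally many zeros, namely of as many as there are pairs of a
  monic \<open>Q\<close> of degree \<open>P\<close> and a zero modulo \<open>Q\<close> in \<open>n - 2\<close> variables.

  These pairs are counted by fixing \<open>Q\<close>, the \<open>x\<^sub>i\<close> and \<open>z\<close>: the congruence is linear in the \<open>y\<^sub>i\<close> and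
  solvable iff \<open>h = gcd(Q, x)\<close> divides \<open>z\<^sup>2\<close>. If \<open>h = a b\<^sup>2\<close> with \<open>a\<close> squarefree, this means that
  \<open>a b\<close> divides \<open>z\<close>. The total is a convolution of two sequences with rational generating functions.
  Finally, dividing by the content passes from all zeros to the primitive ones.
\<close>

section \<open>Polynomials of bounded degree\<close>

text \<open>Phrased by coefficients because \<open>degree 0 = 0\<close>: the zero polynomial has to
  lie in every \<open>polys_lt d\<close>, in particular in \<open>polys_lt 0\<close>.\<close>

definition polys_lt :: "nat \<Rightarrow> 'a::zero poly set" where
  "polys_lt d = {p. \<forall>i\<ge>d. coeff p i = 0}"

definition monics :: "nat \<Rightarrow> 'a::comm_semiring_1 poly set" where
  "monics d = {p. degree p = d \<and> lead_coeff p = 1}"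

lemma polys_lt_0 [simp]: "polys_lt 0 = {0}"
  by (auto simp: polys_lt_def poly_eq_iff)

lemma zero_in_polys_lt [simp]: "0 \<in> polys_lt d"
  by (simp add: polys_lt_def)

lemma polys_lt_iff: "p \<in> polys_lt d \<longleftrightarrow> p = 0 \<or> degree p < d"
proof
  assume p: "p \<in> polys_lt d"
  have "lead_coeff p = 0" if "\<not> degree p < d" using p that unfolding polys_lt_def by simp
  then show "p = 0 \<or> degree p < d" by auto
qed (auto simp: polys_lt_def coeff_eq_0)

lemma polys_lt_Suc_iff: "p \<in> polys_lt (Suc d) \<longleftrightarrow> degree p \<le> d"
  by (auto simp: polys_lt_iff)

lemma polys_lt_add: "p \<in> polys_lt d \<Longrightarrow> r \<in> polys_lt d \<Longrightarrow> p + r \<in> polys_lt d"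
  by (auto simp: polys_lt_def)

lemma polys_lt_diff: "p \<in> polys_lt d \<Longrightarrow> r \<in> polys_lt d \<Longrightarrow> p - r \<in> polys_lt d"
  for p r :: "'a::ab_group_add poly"
  by (auto simp: polys_lt_def)

lemma polys_lt_smult: "p \<in> polys_lt d \<Longrightarrow> smult c p \<in> polys_lt d"
  by (auto simp: polys_lt_def)

lemma polys_lt_sum: "(\<And>i. i \<in> S \<Longrightarrow> f i \<in> polys_lt d) \<Longrightarrow> sum f S \<in> polys_lt d"
  by (auto simp: polys_lt_def coeff_sum)

lemma polys_lt_mono: "d \<le> e \<Longrightarrow> polys_lt d \<subseteq> polys_lt e"
  by (auto simp: polys_lt_def)

lemma polys_lt_mult_monic:
  fixes h :: "'a::idom poly"
  assumes "h \<in> monics j"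
  shows "h * p \<in> polys_lt (j + d) \<longleftrightarrow> p \<in> polys_lt d"
proof -
  have "h \<noteq> 0" "degree h = j" using assms by (auto simp: monics_def)
  then show ?thesis by (cases "p = 0") (auto simp: polys_lt_iff degree_mult_eq)
qed

lemma card_polys_lt: "card (polys_lt d :: 'a::{finite,zero} poly set) = CARD('a) ^ d"
  and finite_polys_lt [simp]: "finite (polys_lt d :: 'a::{finite,zero} poly set)"
proof -
  have "card (polys_lt d :: 'a poly set) = CARD('a) ^ d \<and> finite (polys_lt d :: 'a poly set)"
  proof (induction d)
    case (Suc d)
    have "bij_betw (\<lambda>(c, p). pCons c p) (UNIV \<times> polys_lt d) (polys_lt (Suc d) :: 'a poly set)"
    proof (rule bij_betwI')
      fix y :: "'a poly" assume y: "y \<in> polys_lt (Suc d)"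
      obtain c p where "y = pCons c p" by (cases y)
      with y have "p \<in> polys_lt d" by (force simp: polys_lt_def coeff_pCons split: nat.splits)
      with \<open>y = pCons c p\<close> show "\<exists>x\<in>UNIV \<times> polys_lt d. y = (case x of (c, p) \<Rightarrow> pCons c p)"
        by auto
    qed (auto simp: polys_lt_def coeff_pCons split: nat.splits)
    from bij_betw_same_card[OF this] bij_betw_finite[OF this] show ?case
      using Suc by (simp add: card_cartesian_product finite_cartesian_product_iff)
  qed simp
  then show "card (polys_lt d :: 'a poly set) = CARD('a) ^ d" "finite (polys_lt d :: 'a poly set)"
    by auto
qed

lemma bij_betw_monics:
  "bij_betw (\<lambda>p. monom 1 d + p) (polys_lt d) (monics d :: 'a::comm_ring_1 poly set)"
proof (rule bij_betwI[where g = "\<lambda>p. p - monom 1 d"])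
  show "(\<lambda>p. monom 1 d + p) \<in> polys_lt d \<rightarrow> (monics d :: 'a poly set)"
  proof
    fix p :: "'a poly" assume p: "p \<in> polys_lt d"
    have c: "coeff (monom 1 d + p) d = 1" using p by (simp add: polys_lt_def)
    have "degree (monom 1 d + p) = d"
      by (rule antisym, rule degree_le) (use p c in \<open>auto simp: polys_lt_def intro: le_degree\<close>)
    with c show "monom 1 d + p \<in> monics d" by (simp add: monics_def)
  qed
qed (auto simp: monics_def polys_lt_def coeff_eq_0 le_less)

lemma finite_monics [simp]: "finite (monics d :: 'a::{finite,comm_ring_1} poly set)"
  by (simp add: bij_betw_finite[OF bij_betw_monics, symmetric])

lemma card_monics: "card (monics d :: 'a::{finite,comm_ring_1} poly set) = CARD('a) ^ d"
  by (simp add: bij_betw_same_card[OF bij_betw_monics, symmetric] card_polys_lt)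

lemma monicsD: "h \<in> monics d \<Longrightarrow> h \<noteq> 0" "h \<in> monics d \<Longrightarrow> degree h = d"
    "h \<in> monics d \<Longrightarrow> coeff h d = 1"
  by (auto simp: monics_def)

lemma monics_0 [simp]: "monics 0 = {1 :: 'a::comm_ring_1 poly}"
  by (auto simp: monics_def elim: degree_eq_zeroE)

lemma monics_mult:
  fixes h :: "'a::idom poly"
  assumes "h \<in> monics j"
  shows "h * p \<in> monics (j + d) \<longleftrightarrow> p \<in> monics d"
proof -
  have "h \<noteq> 0" "degree h = j" "lead_coeff h = 1" using assms by (auto simp: monics_def)
  then show ?thesis
    using lead_coeff_mult[of h p]
    by (cases "p = 0") (auto simp: monics_def degree_mult_eq)
qed

lemma monics_mult_in: "h \<in> monics j \<Longrightarrow> p \<in> monics d \<Longrightarrow> h * p \<in> monics (j + d)"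
  for h :: "'a::idom poly"
  by (simp add: monics_mult)

lemma unit_factor_field_gcd: "unit_factor (c :: 'a::field_gcd) = c"
  by (cases "c = 0") (auto simp: is_unit_unit_factor dvd_field_iff)

text \<open>Links the normalization behind \<open>gcd\<close> and \<open>Gcd\<close> with leading
  coefficients, so that every nonzero gcd is an element of some \<open>monics d\<close>.\<close>

lemma normalize_eq_iff_monic:
  fixes p :: "'a::field_gcd poly"
  assumes "p \<noteq> 0"
  shows "normalize p = p \<longleftrightarrow> lead_coeff p = 1"
proof
  assume "normalize p = p"
  then have "coeff (normalize p) (degree p) = coeff p (degree p)" by simp
  then show "lead_coeff p = 1"
    using assms by (simp add: unit_factor_field_gcd)
qed (simp add: poly_eq_iff unit_factor_field_gcd)

lemma normalize_monic: "h \<in> monics d \<Longrightarrow> normalize h = h"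
  for h :: "'a::field_gcd poly"
  by (subst normalize_eq_iff_monic) (auto simp: monics_def)

lemma monic_of_normalize: "normalize h = h \<Longrightarrow> h \<noteq> 0 \<Longrightarrow> h \<in> monics (degree h)"
  for h :: "'a::field_gcd poly"
  by (simp add: monics_def normalize_eq_iff_monic)

section \<open>Residue classes and linear congruences modulo monic polynomials\<close>

lemma mod_monic_in: "h \<in> monics d \<Longrightarrow> p mod h \<in> polys_lt d"
  for h :: "'a::field poly"
  using degree_mod_less[of h p] by (auto simp: monicsD polys_lt_iff)

lemma polys_lt_dvd_eq_0:
  fixes h :: "'a::field poly"
  assumes "h \<in> monics d" "p \<in> polys_lt d" "h dvd p"
  shows "p = 0"
proof (rule ccontr)
  assume "p \<noteq> 0"
  then have "d \<le> degree p" using dvd_imp_degree_le[of h p] assms monicsD(2) by blast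
  with \<open>p \<noteq> 0\<close> assms(2) show False by (simp add: polys_lt_iff)
qed

text \<open>The elements of the residue class are \<open>r mod g + g * v\<close>, and the degree
  bound leaves \<open>P - j\<close> free coefficients for \<open>v\<close>.\<close>

lemma card_polys_lt_cong:
  fixes g :: "'a::{finite,field} poly"
  assumes g: "g \<in> monics j" and "j \<le> P"
  shows "card {y \<in> polys_lt P. g dvd y - r} = CARD('a) ^ (P - j)"
proof -
  have "bij_betw (\<lambda>v. r mod g + g * v) (polys_lt (P - j)) {y \<in> polys_lt P. g dvd y - r}"
  proof (rule bij_betwI[where g = "\<lambda>y. (y - r mod g) div g"])
    have r: "r mod g \<in> polys_lt P"
      using mod_monic_in[OF g] polys_lt_mono[OF \<open>j \<le> P\<close>] by blast
    have dv: "g dvd r mod g - r" by (simp add: mod_eq_dvd_iff[symmetric])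
    have P: "P = j + (P - j)" using \<open>j \<le> P\<close> by simp
    show "(\<lambda>v. r mod g + g * v) \<in> polys_lt (P - j) \<rightarrow> {y \<in> polys_lt P. g dvd y - r}"
    proof safe
      fix v :: "'a poly" assume "v \<in> polys_lt (P - j)"
      then have "g * v \<in> polys_lt P"
        using polys_lt_mult_monic[OF g] P by metis
      then show "r mod g + g * v \<in> polys_lt P" using r polys_lt_add by blast
      have "r mod g + g * v - r = (r mod g - r) + g * v" by simp
      then show "g dvd r mod g + g * v - r" using dv by (metis dvd_add dvd_triv_left)
    qed
    show "(\<lambda>y. (y - r mod g) div g) \<in> {y \<in> polys_lt P. g dvd y - r} \<rightarrow> polys_lt (P - j)"
    proof safe
      fix y assume y: "y \<in> polys_lt P" "g dvd y - r"
      have "g dvd y - r mod g" using y(2) by (simp add: mod_eq_dvd_iff[symmetric])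
      then have "g * ((y - r mod g) div g) = y - r mod g" by simp
      then have "g * ((y - r mod g) div g) \<in> polys_lt P" using r y polys_lt_diff by metis
      then show "(y - r mod g) div g \<in> polys_lt (P - j)"
        using polys_lt_mult_monic[OF g] P by metis
    qed
    fix v :: "'a poly"
    show "(r mod g + g * v - r mod g) div g = v" using monicsD(1)[OF g] by simp
  next
    fix y assume "y \<in> {y \<in> polys_lt P. g dvd y - r}"
    then have "g dvd y - r mod g" by (simp add: mod_eq_dvd_iff[symmetric])
    then show "r mod g + g * ((y - r mod g) div g) = y" by simp
  qed
  then show ?thesis by (simp add: bij_betw_same_card[symmetric] card_polys_lt)
qed

text \<open>After division by \<open>gcd g x\<close> the coefficient of \<open>y\<close> is
  invertible modulo the cofactor \<open>g'\<close> of \<open>g\<close>, so a solvable congruence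
  singles out one residue class modulo \<open>g'\<close>. The factor \<open>CARD('a) ^ j\<close> on
  the left avoids a truncated difference in the exponent.\<close>

lemma card_lin_cong:
  fixes g :: "'a::{finite,field_gcd} poly"
  assumes g: "g \<in> monics j" and "j \<le> P"
  shows "card {y \<in> polys_lt P. g dvd x * y + w} * CARD('a) ^ j =
           (if gcd g x dvd w then CARD('a) ^ (P + degree (gcd g x)) else 0)"
proof (cases "gcd g x dvd w")
  case False
  have "{y \<in> polys_lt P. g dvd x * y + w} = {}"
  proof safe
    fix y assume "g dvd x * y + w"
    then have "gcd g x dvd x * y + w" using dvd_trans gcd_dvd1 by blast
    then have "gcd g x dvd w" by (simp add: dvd_add_right_iff)
    with False show "y \<in> {}" by simp
  qed
  then have "card {y \<in> polys_lt P. g dvd x * y + w} = 0" by (simp only: card.empty)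
  with False show ?thesis by simp
next
  case True
  let ?e = "gcd g x"
  have g0: "g \<noteq> 0" using g monicsD by blast
  then have e0: "?e \<noteq> 0" by simp
  have e: "?e \<in> monics (degree ?e)" using e0 by (intro monic_of_normalize) auto
  obtain g' where g': "g = ?e * g'" using gcd_dvd1[of g x] by (elim dvdE)
  obtain x' where x': "x = ?e * x'" using gcd_dvd2[of g x] by (elim dvdE)
  obtain w' where w': "w = ?e * w'" using True by (elim dvdE)
  have dj: "degree ?e + degree g' = j"
  proof -
    have "g' \<noteq> 0" using g' g0 by (metis mult_zero_right)
    from degree_mult_eq[OF e0 this] show ?thesis
      using monicsD(2)[OF g] unfolding g'[symmetric] by simp
  qed
  have gm: "g' \<in> monics (degree g')"
    using monics_mult[OF e, of g' "degree g'"] g g' dj by simp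
  have "coprime g' x'"
    using e0 g' x' by (intro gcd_coprime[of g x]) (simp_all add: mult.commute)
  \<comment> \<open>By Bezout \<open>v\<close> inverts \<open>x'\<close> modulo \<open>g'\<close>,
    hence the solutions \<open>y\<close> form the class of \<open>- (v * w')\<close>.\<close>
  then obtain u v where uv: "u * g' + v * x' = 1"
    using bezout_coefficients_fst_snd[of g' x'] by (auto simp: coprime_iff_gcd_eq_1)
  have iff: "g dvd x * y + w \<longleftrightarrow> g' dvd y - (- (v * w'))" for y
  proof -
    have "x * y + w = ?e * (x' * y + w')"
    proof -
      have "x * y + w = (?e * x') * y + ?e * w'" by (simp only: x'[symmetric] w'[symmetric])
      also have "\<dots> = ?e * (x' * y + w')" by (simp add: distrib_left mult.assoc)
      finally show ?thesis .
    qed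
    then have "g dvd x * y + w \<longleftrightarrow> ?e * g' dvd ?e * (x' * y + w')" using g' by argo
    also have "\<dots> \<longleftrightarrow> g' dvd x' * y + w'" by (rule dvd_mult_cancel_left[THEN trans]) (use e0 in blast)
    also have "\<dots> \<longleftrightarrow> g' dvd y - (- (v * w'))"
    proof
      assume "g' dvd x' * y + w'"
      then have "g' dvd v * (x' * y + w') + g' * (u * y)" by (meson dvd_add dvd_mult dvd_triv_left)
      also have "v * (x' * y + w') + g' * (u * y) = (u * g' + v * x') * y + v * w'"
        by (simp add: algebra_simps)
      finally show "g' dvd y - (- (v * w'))" by (simp add: uv)
    next
      assume "g' dvd y - (- (v * w'))"
      then have "g' dvd x' * (y - (- (v * w'))) + g' * (u * w')"
        by (meson dvd_add dvd_mult dvd_triv_left)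
      also have "x' * (y - (- (v * w'))) + g' * (u * w') = x' * y + (u * g' + v * x') * w'"
        by (simp add: algebra_simps)
      finally show "g' dvd x' * y + w'" by (simp add: uv)
    qed
    finally show ?thesis .
  qed
  have "card {y \<in> polys_lt P. g dvd x * y + w} = CARD('a) ^ (P - degree g')"
    unfolding iff using gm dj \<open>j \<le> P\<close> by (intro card_polys_lt_cong) auto
  moreover have "P - degree g' + j = P + degree ?e" using dj \<open>j \<le> P\<close> by simp
  ultimately show ?thesis using True by (simp add: power_add[symmetric])
qed

lemma card_PiE_insert_split:
  assumes "i \<notin> I" "finite I" "finite A"
  shows "card {y \<in> insert i I \<rightarrow>\<^sub>E A. Pr y} = (\<Sum>t\<in>A. card {y \<in> I \<rightarrow>\<^sub>E A. Pr (y(i := t))})"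
proof -
  let ?S = "SIGMA t:A. {y \<in> I \<rightarrow>\<^sub>E A. Pr (y(i := t))}"
  have fin: "finite (I \<rightarrow>\<^sub>E A)" using assms by (intro finite_PiE) auto
  have "bij_betw (\<lambda>(t, y). y(i := t)) ?S {y \<in> insert i I \<rightarrow>\<^sub>E A. Pr y}"
  proof (rule bij_betwI[where g = "\<lambda>y. (y i, y(i := undefined))"])
    fix p assume "p \<in> ?S"
    moreover have "undefined = y i" if "y \<in> I \<rightarrow>\<^sub>E A" for y
      using that \<open>i \<notin> I\<close> by (auto simp: PiE_def extensional_def)
    ultimately show "((\<lambda>(t, y). y(i := t)) p i, ((\<lambda>(t, y). y(i := t)) p)(i := undefined)) = p"
      by (auto simp: fun_eq_iff)
  next
    show "(\<lambda>(t, y). y(i := t)) \<in> ?S \<rightarrow> {y \<in> insert i I \<rightarrow>\<^sub>E A. Pr y}"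
      by (auto simp: PiE_iff extensional_def)
    show "(\<lambda>y. (y i, y(i := undefined))) \<in> {y \<in> insert i I \<rightarrow>\<^sub>E A. Pr y} \<rightarrow> ?S"
      using \<open>i \<notin> I\<close> by (auto simp: PiE_iff extensional_def)
  qed auto
  from bij_betw_same_card[OF this, symmetric] show ?thesis
    using assms fin by (simp add: card_SigmaI)
qed

text \<open>Induction on \<open>I\<close> with \<open>w\<close> arbitrary: the new term
  \<open>x i * t\<close> is absorbed into \<open>w\<close>, and the induction hypothesis turns
  solvability in the old unknowns into a congruence for \<open>t\<close> alone, whose modulus is the
  gcd of \<open>Q\<close> and the old coefficients.\<close>

lemma card_lin_cong_PiE:
  fixes Q :: "'a::{finite,field_gcd} poly"
  assumes Q: "Q \<in> monics P" and "finite I"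
  shows "card {y \<in> I \<rightarrow>\<^sub>E polys_lt P. Q dvd (\<Sum>i\<in>I. x i * y i) + w} * CARD('a) ^ P =
           (if Gcd (insert Q (x ` I)) dvd w
            then CARD('a) ^ (P * card I + degree (Gcd (insert Q (x ` I)))) else 0)"
  using \<open>finite I\<close>
proof (induction I arbitrary: w rule: finite_induct)
  case empty
  then show ?case using monicsD[OF Q] normalize_monic[OF Q] by simp
next
  case (insert i I)
  let ?g = "Gcd (insert Q (x ` I))" and ?q = "CARD('a)"
  let ?G = "Gcd (insert Q (x ` insert i I))"
  have G: "?G = gcd ?g (x i)" by (simp add: ac_simps)
  have g0: "?g \<noteq> 0" using monicsD(1)[OF Q] by simp
  have g: "?g \<in> monics (degree ?g)" using g0 by (intro monic_of_normalize) auto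
  have gP: "degree ?g \<le> P"
    using dvd_imp_degree_le[of ?g Q] monicsD[OF Q] by simp
  have sp: "(\<Sum>k\<in>insert i I. x k * (y(i := t)) k) + w = (\<Sum>k\<in>I. x k * y k) + (x i * t + w)" for y t
  proof -
    have "(\<Sum>k\<in>I. x k * (y(i := t)) k) = (\<Sum>k\<in>I. x k * y k)"
      using insert.hyps by (intro sum.cong) auto
    then show ?thesis using insert.hyps by (simp add: algebra_simps)
  qed
  have "card {y \<in> insert i I \<rightarrow>\<^sub>E polys_lt P. Q dvd (\<Sum>i\<in>insert i I. x i * y i) + w} * ?q ^ P =
     (\<Sum>t\<in>polys_lt P. card {y \<in> I \<rightarrow>\<^sub>E polys_lt P. Q dvd (\<Sum>k\<in>I. x k * y k) + (x i * t + w)} * ?q ^ P)"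
    using insert.hyps by (subst card_PiE_insert_split) (simp_all only: sp sum_distrib_right finite_polys_lt not_False_eq_True)
  also have "\<dots> = (\<Sum>t\<in>polys_lt P. if ?g dvd x i * t + w then ?q ^ (P * card I + degree ?g) else 0)"
    by (intro sum.cong refl insert.IH)
  also have "\<dots> = card {t \<in> polys_lt P. ?g dvd x i * t + w} * ?q ^ (P * card I + degree ?g)"
    by (subst sum.inter_filter[symmetric]) simp_all
  \<comment> \<open>The factor \<open>?q ^ degree ?g\<close> from the induction hypothesis is the
    one that \<open>card_lin_cong\<close> carries for the modulus \<open>?g\<close>.\<close>
  also have "\<dots> = (card {t \<in> polys_lt P. ?g dvd x i * t + w} * ?q ^ degree ?g) * ?q ^ (P * card I)"
    by (simp add: power_add)
  also have "\<dots> = (if ?G dvd w then ?q ^ (P + degree ?G) else 0) * ?q ^ (P * card I)"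
    unfolding G by (simp only: card_lin_cong[OF g gP])
  also have "\<dots> = (if ?G dvd w then ?q ^ (P * card (insert i I) + degree ?G) else 0)"
    using insert.hyps by (simp add: power_add mult_ac)
  finally show ?case .
qed

section \<open>Grouping by content\<close>

text \<open>A vector is uniquely its content times a primitive vector. The setting is abstract
  because it serves both moduli with residue vectors and isotropic vectors: \<open>W d\<close> is
  the stratum of size \<open>d\<close>, \<open>sc\<close> is scaling, and \<open>F\<close> is a
  weight depending on the content only.\<close>

lemma sum_by_content:
  fixes W :: "nat \<Rightarrow> 'v set" and cont :: "'v \<Rightarrow> 'a::{finite,field_gcd} poly"
    and sc :: "'a poly \<Rightarrow> 'v \<Rightarrow> 'v" and F :: "'a poly \<Rightarrow> nat"
  assumes fin: "\<And>d. finite (W d)"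
    and sc: "\<And>h j v d. h \<in> monics j \<Longrightarrow> v \<in> W d \<Longrightarrow> sc h v \<in> W (j + d)"
    and cont_sc: "\<And>h j v d. h \<in> monics j \<Longrightarrow> v \<in> W d \<Longrightarrow> cont (sc h v) = h * cont v"
    and inj: "\<And>h j v v' d. h \<in> monics j \<Longrightarrow> v \<in> W d \<Longrightarrow> v' \<in> W d \<Longrightarrow> sc h v = sc h v' \<Longrightarrow> v = v'"
    and decomp: "\<And>v d. v \<in> W d \<Longrightarrow>
      \<exists>j\<le>d. cont v \<in> monics j \<and> (\<exists>v'\<in>W (d - j). v = sc (cont v) v')"
  shows "(\<Sum>v\<in>W P. F (cont v)) =
           (\<Sum>j\<le>P. (\<Sum>h\<in>monics j. F h) * card {v \<in> W (P - j). cont v = 1})"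
proof -
  define S :: "(nat \<times> 'a poly \<times> 'v) set" where "S = (SIGMA j:{..P}. monics j \<times> {v \<in> W (P - j). cont v = 1})"
  define f where "f = (\<lambda>(j::nat, h::'a poly, v). sc h v)"
  have cf: "cont (f p) = fst (snd p)" and fW: "f p \<in> W P" if p: "p \<in> S" for p
  proof -
    obtain j h v where "p = (j, h, v)" "j \<le> P" "h \<in> monics j" "v \<in> W (P - j)" "cont v = 1"
      using p by (auto simp: S_def)
    then show "cont (f p) = fst (snd p)" "f p \<in> W P"
      using sc[of h j v "P - j"] cont_sc[of h j v "P - j"] by (auto simp: f_def)
  qed
  have "bij_betw f S (W P)"
    unfolding bij_betw_def
  proof
    show "inj_on f S"
    proof (rule inj_onI)
      fix p p' assume p: "p \<in> S" and p': "p' \<in> S" and eq: "f p = f p'"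
      obtain j h v where 1: "p = (j, h, v)" "h \<in> monics j" "v \<in> W (P - j)"
        using p by (auto simp: S_def)
      obtain j' h' v' where 2: "p' = (j', h', v')" "h' \<in> monics j'" "v' \<in> W (P - j')"
        using p' by (auto simp: S_def)
      \<comment> \<open>The content recovers \<open>h\<close>, its degree recovers \<open>j\<close>,
        and cancelling \<open>h\<close> recovers \<open>v\<close>.\<close>
      have "h = h'" using cf[OF p] cf[OF p'] eq 1 2 by simp
      moreover from this have "j = j'" using 1 2 monicsD(2) by blast
      ultimately show "p = p'" using 1 2 eq inj by (auto simp: f_def)
    qed
    show "f ` S = W P"
    proof (intro equalityI subsetI)
      fix v assume v: "v \<in> W P"
      from decomp[OF v] obtain j v' where j: "j \<le> P" "cont v \<in> monics j" "v' \<in> W (P - j)"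
        and vv: "v = sc (cont v) v'" by blast
      have "cont v = cont v * cont v'" using cont_sc[OF j(2,3)] vv by simp
      then have "cont v' = 1" using monicsD(1)[OF j(2)] by simp
      then have "(j, cont v, v') \<in> S" using j by (auto simp: S_def)
      moreover have "f (j, cont v, v') = v" using vv by (simp add: f_def)
      ultimately show "v \<in> f ` S" by (metis imageI)
    qed (use fW in auto)
  qed
  then have "(\<Sum>v\<in>W P. F (cont v)) = (\<Sum>p\<in>S. F (cont (f p)))"
    by (rule sum.reindex_bij_betw[symmetric])
  also have "\<dots> = (\<Sum>p\<in>S. F (fst (snd p)))" by (intro sum.cong refl) (simp add: cf)
  also have "\<dots> = (\<Sum>j\<le>P. \<Sum>p\<in>monics j \<times> {v \<in> W (P - j). cont v = 1}. F (fst p))"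
    unfolding S_def using fin by (subst sum.Sigma) (auto intro: sum.cong)
  also have "\<dots> = (\<Sum>j\<le>P. (\<Sum>h\<in>monics j. F h) * card {v \<in> W (P - j). cont v = 1})"
    by (simp add: sum.cartesian_product' sum_distrib_right mult.commute)
  finally show ?thesis .
qed

section \<open>Moduli with residue vectors and their content\<close>

lemma Gcd_mult_monic:
  fixes h :: "'a::field_gcd poly"
  shows "h \<in> monics j \<Longrightarrow> Gcd ((*) h ` A) = h * Gcd A"
  by (simp add: Gcd_mult normalize_mult normalize_monic)

text \<open>A modulus \<open>Q\<close> with a vector of reduced residues modulo \<open>Q\<close>;
  the modulus varies with the vector, so that a common factor can be divided out of both.\<close>

definition moduli_vectors :: "'i set \<Rightarrow> nat \<Rightarrow> ('a::comm_semiring_1 poly \<times> ('i \<Rightarrow> 'a poly)) set" where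
  "moduli_vectors I d = monics d \<times> (I \<rightarrow>\<^sub>E polys_lt d)"

text \<open>The modulus enters the gcd, hence the content is nonzero on
  \<open>moduli_vectors\<close> even when all residues vanish.\<close>

definition vec_content :: "'i set \<Rightarrow> 'a::field_gcd poly \<times> ('i \<Rightarrow> 'a poly) \<Rightarrow> 'a poly" where
  "vec_content I = (\<lambda>(Q, x). Gcd (insert Q (x ` I)))"

text \<open>For finite \<open>I\<close> this is the sum, over monic \<open>Q\<close> of degree
  \<open>d\<close>, of Jordan's totient of order \<open>card I\<close>.\<close>

definition num_coprime :: "'a::{finite,field_gcd} itself \<Rightarrow> 'i set \<Rightarrow> nat \<Rightarrow> nat" where
  "num_coprime _ I d = card {v \<in> moduli_vectors I d. vec_content I v = (1 :: 'a poly)}"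

lemma sum_moduli_vectors:
  fixes F :: "'a::{finite,field_gcd} poly \<Rightarrow> nat" and I :: "'i set"
  assumes "finite I"
  shows "(\<Sum>v\<in>moduli_vectors I P. F (vec_content I v)) =
           (\<Sum>j\<le>P. (\<Sum>h\<in>monics j. F h) * num_coprime TYPE('a) I (P - j))"
  unfolding num_coprime_def
proof (rule sum_by_content[where sc = "\<lambda>h (Q, x). (h * Q, \<lambda>i\<in>I. h * x i)"])
  show "finite (moduli_vectors I d :: ('a poly \<times> _) set)" for d
    using assms by (auto simp: moduli_vectors_def intro!: finite_PiE finite_cartesian_product)
next
  fix h :: "'a poly" and j and v :: "'a poly \<times> ('i \<Rightarrow> 'a poly)" and d assume h: "h \<in> monics j" and v: "v \<in> moduli_vectors I d"
  obtain Q x where vQ: "v = (Q, x)" by (cases v)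
  show "(case v of (Q, x) \<Rightarrow> (h * Q, \<lambda>i\<in>I. h * x i)) \<in> moduli_vectors I (j + d)"
    using v h by (auto simp: vQ moduli_vectors_def monics_mult polys_lt_mult_monic PiE_iff)
  have "vec_content I (h * Q, \<lambda>i\<in>I. h * x i) = Gcd ((*) h ` insert Q (x ` I))"
    unfolding vec_content_def by (auto simp: image_image intro!: arg_cong[where f = Gcd])
  then show "vec_content I (case v of (Q, x) \<Rightarrow> (h * Q, \<lambda>i\<in>I. h * x i)) = h * vec_content I v"
    using h by (simp add: vQ vec_content_def Gcd_mult_monic del: Gcd_insert image_insert)
next
  fix h :: "'a poly" and j and v v' :: "'a poly \<times> ('i \<Rightarrow> 'a poly)" and d
  assume h: "h \<in> monics j" and v: "v \<in> moduli_vectors I d" "v' \<in> moduli_vectors I d"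
    and eq: "(case v of (Q, x) \<Rightarrow> (h * Q, \<lambda>i\<in>I. h * x i)) =
             (case v' of (Q, x) \<Rightarrow> (h * Q, \<lambda>i\<in>I. h * x i))"
  obtain Q x Q' x' where vQ: "v = (Q, x)" "v' = (Q', x')" by (cases v, cases v')
  have h0: "h \<noteq> 0" using h monicsD by blast
  have "x i = x' i" for i
  proof (cases "i \<in> I")
    case True
    have "(\<lambda>i\<in>I. h * x i) i = (\<lambda>i\<in>I. h * x' i) i" using eq vQ by simp
    with True h0 show ?thesis by simp
  qed (use v vQ in \<open>auto simp: moduli_vectors_def PiE_iff extensional_def\<close>)
  with eq vQ h0 show "v = v'" by auto
next
  fix v :: "'a poly \<times> ('i \<Rightarrow> 'a poly)" and d assume v: "v \<in> moduli_vectors I d"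
  obtain Q x where vQ: "v = (Q, x)" by (cases v)
  let ?g = "vec_content I v"
  have Q: "Q \<in> monics d" and x: "x \<in> I \<rightarrow>\<^sub>E polys_lt d" using v vQ by (auto simp: moduli_vectors_def)
  have gQ: "?g dvd Q" and gx: "\<And>i. i \<in> I \<Longrightarrow> ?g dvd x i"
    unfolding vQ vec_content_def by (auto intro: Gcd_dvd simp del: Gcd_insert)
  have g0: "?g \<noteq> 0" using gQ monicsD(1)[OF Q] by auto
  have g: "?g \<in> monics (degree ?g)"
    using g0 by (intro monic_of_normalize) (auto simp: vQ vec_content_def)
  have le: "degree ?g \<le> d" using dvd_imp_degree_le[OF gQ] monicsD[OF Q] by simp
  define v' where "v' = (Q div ?g, \<lambda>i\<in>I. x i div ?g)"
  have "v' \<in> moduli_vectors I (d - degree ?g)"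
    using monics_mult[OF g, of "Q div ?g" "d - degree ?g"] Q x gQ gx le
      polys_lt_mult_monic[OF g, of _ "d - degree ?g"]
    by (auto simp: v'_def moduli_vectors_def PiE_iff dvd_mult_div_cancel)
       (metis dvd_mult_div_cancel)
  moreover have "v = (case v' of (Q, x) \<Rightarrow> (?g * Q, \<lambda>i\<in>I. ?g * x i))"
    using gQ gx x by (auto simp: v'_def vQ[symmetric]) (auto simp: vQ fun_eq_iff PiE_iff extensional_def)
  ultimately show "\<exists>j\<le>d. ?g \<in> monics j \<and>
      (\<exists>v'\<in>moduli_vectors I (d - j). v = (case v' of (Q, x) \<Rightarrow> (?g * Q, \<lambda>i\<in>I. ?g * x i)))"
    using g le by blast
qed

text \<open>The number of all vectors is the convolution of \<open>q ^ j\<close> with this sequence.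
  Subtracting \<open>q\<close> times the total at \<open>d\<close> from the total at
  \<open>Suc d\<close> leaves a single term; the additive form avoids subtraction of
  naturals.\<close>

lemma num_coprime_Suc:
  assumes "finite I"
  shows "num_coprime TYPE('a::{finite,field_gcd}) I 0 = 1"
    and "num_coprime TYPE('a) I (Suc d) + CARD('a) * CARD('a) ^ ((card I + 1) * d) =
           CARD('a) ^ ((card I + 1) * Suc d)"
proof -
  let ?q = "CARD('a)" and ?J = "num_coprime TYPE('a) I"
  have tot: "?q ^ ((card I + 1) * d) = (\<Sum>j\<le>d. ?q ^ j * ?J (d - j))" for d
  proof -
    have "card (moduli_vectors I d :: ('a poly \<times> _) set) = ?q ^ d * (?q ^ d) ^ card I"
      using assms by (simp add: moduli_vectors_def card_cartesian_product card_monics card_PiE card_polys_lt)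
    also have "\<dots> = ?q ^ ((card I + 1) * d)" by (simp add: power_add power_mult[symmetric] mult_ac)
    finally show ?thesis
      using sum_moduli_vectors[OF assms, of "\<lambda>_::'a poly. 1" d] by (simp add: card_monics)
  qed
  show "?J 0 = 1" using tot[of 0] by simp
  have "?q ^ ((card I + 1) * Suc d) = ?J (Suc d) + (\<Sum>j\<le>d. ?q ^ Suc j * ?J (d - j))"
    unfolding tot[of "Suc d"] by (subst sum.atMost_Suc_shift) simp
  also have "(\<Sum>j\<le>d. ?q ^ Suc j * ?J (d - j)) = ?q * ?q ^ ((card I + 1) * d)"
    unfolding tot[of d] by (simp add: sum_distrib_left mult_ac)
  finally show "?J (Suc d) + ?q * ?q ^ ((card I + 1) * d) = ?q ^ ((card I + 1) * Suc d)" by simp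
qed

section \<open>Solutions modulo varying moduli\<close>

text \<open>Let \<open>a'\<close> and \<open>z'\<close> be the cofactors of \<open>gcd a z\<close>.
  As they are coprime, \<open>a'\<close> divides that gcd, so \<open>a' ^ 2\<close> divides the
  squarefree \<open>a\<close> and \<open>a'\<close> is a unit.\<close>

lemma squarefree_dvd_square_iff:
  fixes a :: "'a::{semiring_gcd,idom}"
  assumes a: "squarefree a" and a0: "a \<noteq> 0"
  shows "a dvd z ^ 2 \<longleftrightarrow> a dvd z"
proof
  assume dv: "a dvd z ^ 2"
  let ?g = "gcd a z"
  have g0: "?g \<noteq> 0" using a0 by simp
  obtain a' where a': "a = ?g * a'" using gcd_dvd1[of a z] by (elim dvdE)
  obtain z' where z': "z = ?g * z'" using gcd_dvd2[of a z] by (elim dvdE)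
  have cop: "coprime a' z'"
    using g0 a' z' by (intro gcd_coprime[of a z]) (simp_all add: mult.commute)
  have "z ^ 2 = (?g * z') ^ 2" by (simp only: z'[symmetric])
  then have "?g * a' dvd ?g * (?g * z' ^ 2)"
    using dv unfolding a'[symmetric] by (simp add: power2_eq_square mult_ac)
  then have "a' dvd ?g * z' ^ 2" using g0 dvd_times_left_cancel_iff by blast
  then have "a' dvd ?g" using cop by (simp add: coprime_dvd_mult_left_iff)
  then have "a' ^ 2 dvd ?g * a'" by (simp add: power2_eq_square mult_dvd_mono)
  then have "a' dvd 1" using a unfolding a'[symmetric] by (rule squarefreeD[rotated])
  then have "?g * a' dvd ?g" by (metis mult_dvd_mono dvd_refl mult_1_right)
  then have "a dvd ?g" unfolding a'[symmetric] .
  then show "a dvd z" by simp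
qed (simp add: power2_eq_square)

lemma monic_squarefree_decomp:
  fixes h :: "'a::field_gcd poly"
  assumes "h \<in> monics k"
  defines "b \<equiv> square_part h" and "a \<equiv> squarefree_part h"
  shows "b \<in> monics (degree b)" "a \<in> monics (k - 2 * degree b)" "squarefree a"
    "h = a * b ^ 2" "2 * degree b \<le> k"
proof -
  have h0: "h \<noteq> 0" using assms monicsD by blast
  then show bm: "b \<in> monics (degree b)"
    by (intro monic_of_normalize) (auto simp: b_def)
  show "squarefree a" by (auto simp: a_def)
  show hab: "h = a * b ^ 2" unfolding a_def b_def by (rule squarefree_decompose)
  have "b ^ 2 \<in> monics (degree b + degree b)"
    unfolding power2_eq_square using bm by (intro monics_mult_in)
  then have b2: "b ^ 2 \<in> monics (2 * degree b)" by (simp add: mult_2)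
  have "a \<noteq> 0" using hab h0 by auto
  then have "degree h = degree a + 2 * degree b"
    using hab monicsD[OF b2] by (simp add: degree_mult_eq)
  then have k: "k = 2 * degree b + degree a" using monicsD(2)[OF assms(1)] by simp
  then show "2 * degree b \<le> k" by simp
  have "b ^ 2 * a \<in> monics (2 * degree b + degree a)" using hab assms k by (simp add: mult.commute)
  then have "a \<in> monics (degree a)" by (simp add: monics_mult[OF b2])
  then show "a \<in> monics (k - 2 * degree b)" using k by simp
qed

text \<open>Uniqueness in \<open>h = a * b ^ 2\<close>: \<open>b\<close> divides the square part,
  and the square of the cofactor divides the squarefree \<open>a\<close>.\<close>

lemma square_part_mult_square:
  fixes a b :: "'a::field_gcd poly"
  assumes "squarefree a" "b \<in> monics i"
  shows "square_part (a * b ^ 2) = b"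
proof -
  let ?s = "square_part (a * b ^ 2)"
  have "b dvd ?s" by (simp add: dvd_square_part_iff)
  then obtain c where c: "?s = b * c" by (elim dvdE)
  have b0: "b \<noteq> 0" using assms monicsD by blast
  have "?s ^ 2 dvd a * b ^ 2" by (rule square_part_square_dvd)
  then have "b ^ 2 * c ^ 2 dvd b ^ 2 * a" by (simp add: c power_mult_distrib mult_ac)
  then have "c ^ 2 dvd a" using b0 by simp
  then have "c dvd 1" using assms squarefreeD by blast
  then have "normalize ?s = normalize b" unfolding c by (simp add: normalize_mult_unit_right)
  then show ?thesis using normalize_monic assms by fastforce
qed

definition num_squarefree :: "'a::{finite,field_gcd} itself \<Rightarrow> nat \<Rightarrow> nat" where
  "num_squarefree _ k = card {a \<in> monics k. squarefree (a :: 'a poly)}"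

text \<open>Monic \<open>h\<close> correspond to pairs of a monic \<open>b\<close> and a squarefree
  monic \<open>a\<close> via \<open>h = a * b ^ 2\<close>; the factor \<open>CARD('a) ^ i\<close>
  counts the \<open>b\<close> of degree \<open>i\<close>.\<close>

lemma sum_over_square_part:
  fixes G :: "nat \<Rightarrow> nat"
  shows "(\<Sum>h\<in>(monics k :: 'a::{finite,field_gcd} poly set). G (degree (square_part h))) =
           (\<Sum>i\<le>k div 2. G i * CARD('a) ^ i * num_squarefree TYPE('a) (k - 2 * i))"
proof -
  define S :: "(nat \<times> 'a poly \<times> 'a poly) set" where
    "S = (SIGMA i:{..k div 2}. monics i \<times> {a \<in> monics (k - 2 * i). squarefree a})"
  define f where "f = (\<lambda>(i::nat, b::'a poly, a). a * b ^ 2)"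
  have sp: "square_part (f p) = fst (snd p)" "degree (fst (snd p)) = fst p"
    and fW: "f p \<in> monics k" if p: "p \<in> S" for p
  proof -
    obtain i b a where p': "p = (i, b, a)" "2 * i \<le> k" "b \<in> monics i" "a \<in> monics (k - 2 * i)"
      "squarefree a" using p by (auto simp: S_def)
    then show "square_part (f p) = fst (snd p)" "degree (fst (snd p)) = fst p"
      by (auto simp: f_def square_part_mult_square monicsD)
    have "b * b \<in> monics (i + i)" using p' by (intro monics_mult_in)
    then have "a * (b * b) \<in> monics (k - 2 * i + (i + i))" using p' by (intro monics_mult_in)
    then show "f p \<in> monics k" using p' by (simp add: f_def power2_eq_square mult_2[symmetric])
  qed
  have "bij_betw f S (monics k)"
    unfolding bij_betw_def
  proof
    show "inj_on f S"
    proof (rule inj_onI)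
      fix p p' assume p: "p \<in> S" and p': "p' \<in> S" and eq: "f p = f p'"
      have e: "fst (snd p) = fst (snd p')" using sp(1)[OF p] sp(1)[OF p'] eq by simp
      moreover have "fst p = fst p'" using sp(2)[OF p] sp(2)[OF p'] e by simp
      moreover have "fst (snd p) \<noteq> 0" using p by (auto simp: S_def dest: monicsD(1))
      ultimately show "p = p'" using eq by (auto simp: f_def prod_eq_iff split: prod.splits)
    qed
    show "f ` S = monics k"
    proof (intro equalityI subsetI)
      fix h :: "'a poly" assume h: "h \<in> monics k"
      note d = monic_squarefree_decomp[OF h]
      have "(degree (square_part h), square_part h, squarefree_part h) \<in> S"
        using d by (auto simp: S_def)
      moreover have "f (degree (square_part h), square_part h, squarefree_part h) = h"
        using d(4) by (simp add: f_def)
      ultimately show "h \<in> f ` S" by (metis imageI)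
    qed (use fW in auto)
  qed
  then have "(\<Sum>h\<in>(monics k :: 'a poly set). G (degree (square_part h))) =
      (\<Sum>p\<in>S. G (degree (square_part (f p))))"
    by (rule sum.reindex_bij_betw[symmetric])
  also have "\<dots> = (\<Sum>p\<in>S. G (fst p))" by (intro sum.cong refl) (simp add: sp)
  also have "\<dots> = (\<Sum>i\<le>k div 2. \<Sum>p\<in>(monics i :: 'a poly set) \<times> {a \<in> monics (k - 2 * i). squarefree (a :: 'a poly)}. G i)"
  proof -
    have "finite ((monics i :: 'a poly set) \<times> {a \<in> monics (k - 2 * i). squarefree (a :: 'a poly)})" for i
      by (intro finite_cartesian_product) simp_all
    then show ?thesis unfolding S_def by (subst sum.Sigma) (simp_all add: case_prod_beta)
  qed
  also have "\<dots> = (\<Sum>i\<le>k div 2. G i * CARD('a) ^ i * num_squarefree TYPE('a) (k - 2 * i))"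
    by (simp add: card_cartesian_product card_monics num_squarefree_def mult_ac)
  finally show ?thesis .
qed

text \<open>A content \<open>h\<close> multiplies the number of solutions \<open>y\<close> by
  \<open>q ^ degree h\<close>, while the \<open>z\<close> with \<open>h dvd z ^ 2\<close> have
  density \<open>q ^ degree b / q ^ degree h\<close>, where \<open>b\<close> is the square part. The
  product \<open>q ^ degree b\<close> is the weight summed here.\<close>

definition square_weight :: "'a::{finite,field_gcd} itself \<Rightarrow> nat \<Rightarrow> nat" where
  "square_weight _ k = (\<Sum>h\<in>(monics k :: 'a poly set). CARD('a) ^ degree (square_part h))"

text \<open>Both \<open>q ^ k\<close> and the weights are sums over \<open>i\<close> of squarefree
  counts at \<open>k - 2 * i\<close>, with factors \<open>q ^ i\<close> and
  \<open>q ^ (2 * i)\<close>. Passing from \<open>k\<close> to \<open>k + 2\<close> adds only the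
  term \<open>i = 0\<close>, and eliminating this common squarefree count gives the
  recursion.\<close>

lemma square_weight_rec:
  defines "q \<equiv> CARD('a::{finite,field_gcd})"
  shows "square_weight TYPE('a) 0 = 1" "square_weight TYPE('a) (Suc 0) = q"
    "square_weight TYPE('a) (k + 2) + q * q ^ k = q ^ (k + 2) + q ^ 2 * square_weight TYPE('a) k"
proof -
  let ?s = "num_squarefree TYPE('a)" and ?R = "square_weight TYPE('a)"
  have tot: "q ^ k = (\<Sum>i\<le>k div 2. q ^ i * ?s (k - 2 * i))" for k
    using sum_over_square_part[of "\<lambda>_. 1" k, where 'a = 'a] by (simp add: card_monics q_def)
  have R: "?R k = (\<Sum>i\<le>k div 2. q ^ i * q ^ i * ?s (k - 2 * i))" for k
    using sum_over_square_part[of "\<lambda>i. q ^ i" k, where 'a = 'a]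
    by (simp add: square_weight_def q_def)
  show "?R 0 = 1" "?R (Suc 0) = q" using R[of 0] R[of "Suc 0"] tot[of 0] tot[of "Suc 0"] by (simp_all del: One_nat_def)
  have "?R (k + 2) = ?s (k + 2) + (\<Sum>i\<le>k div 2. q ^ Suc i * q ^ Suc i * ?s (k - 2 * i))"
    unfolding R[of "k + 2"] by (simp add: sum.atMost_Suc_shift del: sum.atMost_Suc)
  also have "(\<Sum>i\<le>k div 2. q ^ Suc i * q ^ Suc i * ?s (k - 2 * i)) = q ^ 2 * ?R k"
    unfolding R[of k] by (simp add: sum_distrib_left power2_eq_square mult_ac)
  finally have 1: "?R (k + 2) = ?s (k + 2) + q ^ 2 * ?R k" .
  have "q ^ (k + 2) = ?s (k + 2) + (\<Sum>i\<le>k div 2. q ^ Suc i * ?s (k - 2 * i))"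
    unfolding tot[of "k + 2"] by (simp add: sum.atMost_Suc_shift del: sum.atMost_Suc)
  also have "(\<Sum>i\<le>k div 2. q ^ Suc i * ?s (k - 2 * i)) = q * q ^ k"
    unfolding tot[of k] by (simp add: sum_distrib_left mult_ac)
  finally show "?R (k + 2) + q * q ^ k = q ^ (k + 2) + q ^ 2 * ?R k" using 1 by simp
qed

text \<open>If \<open>h = c * b ^ 2\<close> with \<open>c\<close> squarefree, then
  \<open>h dvd z ^ 2\<close> amounts to \<open>b * c dvd z\<close>, and \<open>b * c\<close> has
  degree \<open>j - degree b\<close>.\<close>

lemma card_square_dvd:
  fixes h :: "'a::{finite,field_gcd} poly"
  assumes h: "h \<in> monics j" and "j \<le> P" and "a \<noteq> 0"
  shows "CARD('a) ^ j * card {z \<in> polys_lt P. h dvd smult a (z ^ 2)} =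
           CARD('a) ^ (P + degree (square_part h))"
proof -
  let ?b = "square_part h" and ?c = "squarefree_part h"
  note d = monic_squarefree_decomp[OF h]
  have b0: "?b \<noteq> 0" and c0: "?c \<noteq> 0" using h monicsD(1) by auto
  \<comment> \<open>The difference \<open>z - 0\<close> has the shape of the residue class count
    with \<open>r = 0\<close>.\<close>
  have iff: "h dvd smult a (z ^ 2) \<longleftrightarrow> ?b * ?c dvd z - 0" for z
  proof -
    have "h dvd z ^ 2 \<longleftrightarrow> ?b * ?c dvd z"
    proof
      assume hz: "h dvd z ^ 2"
      then have "?b ^ 2 dvd z ^ 2" using square_part_square_dvd dvd_trans by blast
      then have "?b dvd z" by simp
      then obtain z' where z: "z = ?b * z'" by (elim dvdE)
      have "?b ^ 2 * ?c dvd (?b * z') ^ 2" using hz d(4) z by (simp add: mult.commute)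
      then have "?c dvd z' ^ 2" using b0 by (simp add: power_mult_distrib)
      then have "?c dvd z'" using squarefree_dvd_square_iff[OF d(3) c0] by blast
      then show "?b * ?c dvd z" by (simp add: z)
    next
      assume "?b * ?c dvd z"
      then have "(?b * ?c) ^ 2 dvd z ^ 2" by (simp only: pow_divides_pow_iff zero_less_numeral)
      moreover have "?c * ?b ^ 2 dvd (?b * ?c) ^ 2" by (simp add: power_mult_distrib power2_eq_square)
      ultimately show "h dvd z ^ 2" using d(4) dvd_trans by metis
    qed
    then show ?thesis using \<open>a \<noteq> 0\<close> by (simp add: dvd_smult_iff)
  qed
  have bc: "?b * ?c \<in> monics (degree ?b + (j - 2 * degree ?b))"
    using d by (intro monics_mult_in)
  then have "card {z \<in> polys_lt P. h dvd smult a (z ^ 2)} = CARD('a) ^ (P - (degree ?b + (j - 2 * degree ?b)))"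
    unfolding iff using d(5) \<open>j \<le> P\<close> by (intro card_polys_lt_cong) auto
  moreover have "j + (P - (degree ?b + (j - 2 * degree ?b))) = P + degree ?b"
    using d(5) \<open>j \<le> P\<close> by linarith
  ultimately show ?thesis by (simp add: power_add[symmetric])
qed

text \<open>The components are grouped in the order of counting: \<open>(Q, x)\<close> fixes the
  content, \<open>z\<close> decides solvability, and \<open>y\<close> solves the remaining linear
  congruence.\<close>

definition divisor_solutions ::
    "'a::field_gcd \<Rightarrow> 'i set \<Rightarrow> nat \<Rightarrow> (('a poly \<times> ('i \<Rightarrow> 'a poly)) \<times> 'a poly \<times> ('i \<Rightarrow> 'a poly)) set" where
  "divisor_solutions a I P = {((Q, x), z, y). (Q, x) \<in> moduli_vectors I P \<and> z \<in> polys_lt P \<and>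
     y \<in> I \<rightarrow>\<^sub>E polys_lt P \<and> Q dvd (\<Sum>i\<in>I. x i * y i) + smult a (z ^ 2)}"

text \<open>For fixed \<open>(Q, x)\<close> and \<open>z\<close> the congruence is linear in
  \<open>y\<close>. Summing its solution count over \<open>z\<close> leaves a function of the
  content alone, so that grouping by content produces a convolution.\<close>

lemma card_divisor_solutions:
  fixes a :: "'a::{finite,field_gcd}" and I :: "'i set"
  assumes "finite I" "a \<noteq> 0"
  shows "card (divisor_solutions a I P) =
    CARD('a) ^ (P * card I) *
      (\<Sum>j\<le>P. square_weight TYPE('a) j * num_coprime TYPE('a) I (P - j))"
proof -
  let ?q = "CARD('a)"
  have finmv: "finite (moduli_vectors I P :: ('a poly \<times> _) set)"
    using assms by (auto simp: moduli_vectors_def intro!: finite_PiE finite_cartesian_product)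
  have finP: "finite (I \<rightarrow>\<^sub>E (polys_lt P :: 'a poly set))" using assms by (intro finite_PiE) auto
  define Y where "Y v z = {y \<in> I \<rightarrow>\<^sub>E polys_lt P.
      fst v dvd (\<Sum>i\<in>I. snd v i * y i) + smult a (z ^ 2)}" for v :: "'a poly \<times> ('i \<Rightarrow> 'a poly)" and z
  have finY: "finite (Y v z)" for v z using finP by (simp add: Y_def)
  have "divisor_solutions a I P = (SIGMA v:moduli_vectors I P. SIGMA z:polys_lt P. Y v z)"
    by (auto simp: divisor_solutions_def Y_def)
  then have "card (divisor_solutions a I P) = (\<Sum>v\<in>moduli_vectors I P. \<Sum>z\<in>polys_lt P. card (Y v z))"
    using finmv finY by (simp add: card_SigmaI)
  \<comment> \<open>The extra factor matches the normalization in \<open>card_lin_cong_PiE\<close>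
    and is cancelled at the end.\<close>
  then have "card (divisor_solutions a I P) * ?q ^ P =
      (\<Sum>v\<in>moduli_vectors I P. \<Sum>z\<in>polys_lt P. card (Y v z) * ?q ^ P)"
    by (simp add: sum_distrib_right)
  also have "\<dots> = (\<Sum>v\<in>(moduli_vectors I P :: ('a poly \<times> ('i \<Rightarrow> 'a poly)) set). ?q ^ (P * card I) * (?q ^ P * ?q ^ degree (square_part (vec_content I v))))"
  proof (intro sum.cong refl)
    fix v :: "'a poly \<times> ('i \<Rightarrow> 'a poly)" assume v: "v \<in> moduli_vectors I P"
    let ?h = "vec_content I v"
    have Q: "fst v \<in> monics P" using v by (auto simp: moduli_vectors_def)
    have h: "?h = Gcd (insert (fst v) (snd v ` I))" by (simp add: vec_content_def case_prod_beta)
    have "?h dvd fst v" unfolding h by (simp)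
    then have hP: "degree ?h \<le> P" using dvd_imp_degree_le[of ?h "fst v"] monicsD[OF Q] by simp
    have h0: "?h \<noteq> 0" using monicsD(1)[OF Q] by (simp add: h)
    have hm: "?h \<in> monics (degree ?h)" using h0 by (intro monic_of_normalize) (simp_all add: h)
    have "(\<Sum>z\<in>polys_lt P. card (Y v z) * ?q ^ P) =
        (\<Sum>z\<in>polys_lt P. if ?h dvd smult a (z ^ 2) then ?q ^ (P * card I + degree ?h) else 0)"
      unfolding h Y_def by (intro sum.cong refl card_lin_cong_PiE[OF Q \<open>finite I\<close>])
    also have "\<dots> = card {z \<in> polys_lt P. ?h dvd smult a (z ^ 2)} * ?q ^ (P * card I + degree ?h)"
      by (subst sum.inter_filter[symmetric]) simp_all
    also have "\<dots> = ?q ^ (P * card I) * (?q ^ P * ?q ^ degree (square_part ?h))"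
      using card_square_dvd[OF hm hP \<open>a \<noteq> 0\<close>] by (simp add: power_add mult_ac)
    finally show "(\<Sum>z\<in>polys_lt P. card (Y v z) * ?q ^ P) = \<dots>" .
  qed
  also have "\<dots> = ?q ^ P * (?q ^ (P * card I) * (\<Sum>v\<in>(moduli_vectors I P :: ('a poly \<times> ('i \<Rightarrow> 'a poly)) set). ?q ^ degree (square_part (vec_content I v))))"
    by (simp add: sum_distrib_left mult_ac)
  also have "(\<Sum>v\<in>(moduli_vectors I P :: ('a poly \<times> ('i \<Rightarrow> 'a poly)) set). ?q ^ degree (square_part (vec_content I v))) =
      (\<Sum>j\<le>P. square_weight TYPE('a) j * num_coprime TYPE('a) I (P - j))"
    using sum_moduli_vectors[OF \<open>finite I\<close>, of "\<lambda>h. ?q ^ degree (square_part h)"]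
    by (simp add: square_weight_def)
  finally show ?thesis by simp
qed

text \<open>The generating function of \<open>D\<close> is
  \<open>D(u) = (1 - q y\<^sup>2 u\<^sup>2) / ((1 - q y\<^sup>2 u) (1 - q\<^sup>2 y\<^sup>2 u\<^sup>2))\<close>.\<close>

lemma convolution_closed_form:
  fixes q y :: real and R J :: "nat \<Rightarrow> real"
  assumes R: "R 0 = 1" "R (Suc 0) = q"
      "\<And>k. R (Suc (Suc k)) = q ^ Suc (Suc k) - q ^ Suc k + q ^ 2 * R k"
    and J: "J 0 = 1" "\<And>d. J (Suc d) = (q * y) ^ Suc d - q * (q * y) ^ d"
  defines "D \<equiv> \<lambda>P. y ^ P * (\<Sum>j\<le>P. R j * J (P - j))"
  shows "D (Suc P) - q * D P =
    (q * y\<^sup>2) ^ Suc P - (q * y\<^sup>2) ^ P - (if even P then (q - 1) * (q * y) ^ P else 0)"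
proof -
  define C where "C = (\<lambda>P. \<Sum>j\<le>P. R j * J (P - j))"
  \<comment> \<open>Apart from a shift by one, these are the coefficients of
    \<open>(1 - q u) R(u) = (1 - q u^2) / (1 - q^2 u^2)\<close>, a series in \<open>u^2\<close>; the
    shift makes them vanish at even indices.\<close>
  define d where "d = (\<lambda>P. R (Suc P) - q * R P)"
  have d_rec: "d (Suc (Suc k)) = q ^ 2 * d k" for k
    by (simp add: d_def R algebra_simps power2_eq_square)
  have d: "d k = (if odd k then q ^ Suc k - q ^ k else 0)" for k
  proof (induction k rule: induct_nat_012)
    case 0 then show ?case by (simp add: d_def R)
  next
    case 1 then show ?case using R(3)[of 0] by (simp add: d_def R power2_eq_square)
  next
    case (ge2 k) then show ?case by (simp add: d_rec algebra_simps power2_eq_square)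
  qed
  \<comment> \<open>Since \<open>J(u) = (1 - q u) / (1 - q y u)\<close>, the product
    \<open>C(u) = R(u) J(u)\<close> satisfies
    \<open>(1 - q y u) C(u) = (1 - q u) R(u)\<close>.\<close>
  have C: "C (Suc P) = q * y * C P + d P" for P
  proof -
    have "C (Suc P) = (\<Sum>j\<le>P. R j * J (Suc (P - j))) + R (Suc P)"
      by (simp add: C_def J Suc_diff_le)
    \<comment> \<open>From index one on \<open>J\<close> is geometric with ratio
      \<open>q * y\<close>; only \<open>J 1\<close> falls short of \<open>q * y * J 0\<close>,
      namely by \<open>q\<close>, which is the correction at \<open>j = P\<close>.\<close>
    also have "(\<Sum>j\<le>P. R j * J (Suc (P - j))) =
        (\<Sum>j\<le>P. q * y * (R j * J (P - j)) - (if j = P then q * R P else 0))"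
    proof (intro sum.cong refl)
      fix j assume "j \<in> {..P}"
      show "R j * J (Suc (P - j)) = q * y * (R j * J (P - j)) - (if j = P then q * R P else 0)"
      proof (cases "j = P")
        case False
        then obtain i where "P - j = Suc i" using \<open>j \<in> {..P}\<close>
          by (metis atMost_iff diff_is_0_eq le_antisym not0_implies_Suc)
        then show ?thesis using False by (simp add: J algebra_simps)
      qed (simp add: J algebra_simps)
    qed
    also have "\<dots> = q * y * C P - q * R P"
      by (simp add: C_def sum_subtractf sum_distrib_left)
    finally show ?thesis by (simp add: d_def)
  qed
  have DC: "D P = y ^ P * C P" for P by (simp add: D_def C_def)
  \<comment> \<open>Multiplication by \<open>1 - q u\<close> is also the effect of dividing out the
    content later, so this difference is the quantity wanted.\<close>
  define B where "B = (\<lambda>P. D (Suc P) - q * D P)"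
  have B_rec: "B (Suc P) = q * y\<^sup>2 * B P + y ^ Suc (Suc P) * d (Suc P) - q * y ^ Suc P * d P" for P
    by (simp add: B_def DC C algebra_simps power2_eq_square)
  have "B P = (q * y\<^sup>2) ^ Suc P - (q * y\<^sup>2) ^ P - (if even P then (q - 1) * (q * y) ^ P else 0)" for P
  proof (induction P)
    case 0
    have "C 0 = 1" by (simp add: C_def R J)
    then show ?case using C[of 0] by (simp add: B_def DC d power2_eq_square algebra_simps)
  next
    case (Suc P)
    show ?case unfolding B_rec Suc.IH
      by (cases "even P") (simp_all add: d algebra_simps power2_eq_square power_mult_distrib)
  qed
  then show ?thesis by (simp add: B_def)
qed

text \<open>The closed form with \<open>y = q ^ card I\<close>. The difference feeds the count of
  primitive zeros, and the value at one yields the number of zeros over the field.\<close>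

lemma card_divisor_solutions_diff:
  fixes a :: "'a::{finite,field_gcd}" and I :: "'i set"
  assumes "finite I" "a \<noteq> 0"
  defines "q \<equiv> real CARD('a)" and "D \<equiv> \<lambda>P. real (card (divisor_solutions a I P))"
  shows "D (Suc P) - q * D P = q ^ ((2 * card I + 1) * Suc P) - q ^ ((2 * card I + 1) * P)
           - (if even P then (q - 1) * q ^ ((card I + 1) * P) else 0)"
    and "D 0 = 1" and "D (Suc 0) = q ^ (2 * card I + 1)"
proof -
  let ?R = "\<lambda>k. real (square_weight TYPE('a) k)" and ?J = "\<lambda>d. real (num_coprime TYPE('a) I d)"
  have R: "?R 0 = 1" "?R (Suc 0) = q" using square_weight_rec(1,2)[where 'a='a] by (auto simp: q_def)
  have R2: "?R (Suc (Suc k)) = q ^ Suc (Suc k) - q ^ Suc k + q ^ 2 * ?R k" for k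
    using arg_cong[OF square_weight_rec(3)[where 'a='a, of k], of real] by (simp add: q_def)
  have J0: "?J 0 = 1" using num_coprime_Suc(1)[OF assms(1), where 'a='a] by simp
  have J: "?J (Suc d) = (q * q ^ card I) ^ Suc d - q * (q * q ^ card I) ^ d" for d
  proof -
    have "?J (Suc d) + q * q ^ ((card I + 1) * d) = q ^ ((card I + 1) * Suc d)"
      using arg_cong[OF num_coprime_Suc(2)[OF assms(1), where 'a='a, of d], of real]
      by (simp only: q_def of_nat_add of_nat_mult of_nat_power)
    moreover have "q ^ ((card I + 1) * n) = (q * q ^ card I) ^ n" for n
      by (simp only: power_mult) simp
    ultimately show ?thesis by (simp only:)
  qed
  have D: "D P = (q ^ card I) ^ P * (\<Sum>j\<le>P. ?R j * ?J (P - j))" for P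
    using card_divisor_solutions[OF assms(1,2), of P]
    by (simp add: D_def q_def power_mult[symmetric] mult.commute)
  have qy: "q * (q ^ card I)\<^sup>2 = q ^ (2 * card I + 1)"
    by (simp add: power_mult[symmetric] mult.commute)
  have cf: "D (Suc P) - q * D P = (q * (q ^ card I)\<^sup>2) ^ Suc P - (q * (q ^ card I)\<^sup>2) ^ P
      - (if even P then (q - 1) * (q * q ^ card I) ^ P else 0)" for P
    unfolding D by (rule convolution_closed_form) (rule R R2 J0 J)+
  then show 1: "D (Suc P) - q * D P = q ^ ((2 * card I + 1) * Suc P) - q ^ ((2 * card I + 1) * P)
           - (if even P then (q - 1) * q ^ ((card I + 1) * P) else 0)" for P
    unfolding qy by (simp only: power_mult) simp
  show 2: "D 0 = 1" using D[of 0] R J0 by simp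
  show "D (Suc 0) = q ^ (2 * card I + 1)" using 1[of 0] 2 by simp
qed

section \<open>Lifting leading coefficients\<close>

text \<open>The recursion for \<open>num_coprime\<close> sees only the size of \<open>I\<close>.
  This allows the removed hyperbolic pair to depend on the leading vector.\<close>

lemma card_divisor_solutions_cong:
  fixes a :: "'a::{finite,field_gcd}" and I :: "'i set" and I' :: "'j set"
  assumes "finite I" "finite I'" "card I = card I'" "a \<noteq> 0"
  shows "card (divisor_solutions a I P) = card (divisor_solutions a I' P)"
proof -
  have "num_coprime TYPE('a) I d = num_coprime TYPE('a) I' d" for d
  proof (cases d)
    case 0 then show ?thesis using assms by (simp add: num_coprime_Suc)
  next
    case (Suc d')
    then show ?thesis
      using num_coprime_Suc(2)[OF assms(1), where 'a='a, of d'] num_coprime_Suc(2)[OF assms(2), where 'a='a, of d']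
        assms(3) by simp
  qed
  then show ?thesis using assms by (simp add: card_divisor_solutions)
qed

definition quadric_vectors ::
    "'a::field_gcd \<Rightarrow> 'i set \<Rightarrow> nat \<Rightarrow> (('i \<Rightarrow> 'a poly) \<times> ('i \<Rightarrow> 'a poly) \<times> 'a poly) set" where
  "quadric_vectors a I d = {(x, y, z). x \<in> I \<rightarrow>\<^sub>E polys_lt d \<and> y \<in> I \<rightarrow>\<^sub>E polys_lt d \<and> z \<in> polys_lt d \<and>
     (\<Sum>i\<in>I. x i * y i) + smult a (z ^ 2) = 0}"

definition quadric_consts :: "'a::field_gcd \<Rightarrow> 'i set \<Rightarrow> (('i \<Rightarrow> 'a) \<times> ('i \<Rightarrow> 'a) \<times> 'a) set" where
  "quadric_consts a I = {(u, v, w). u \<in> I \<rightarrow>\<^sub>E UNIV \<and> v \<in> I \<rightarrow>\<^sub>E UNIV \<and>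
     (\<Sum>i\<in>I. u i * v i) + a * w ^ 2 = 0}"

definition lead_vec :: "'i set \<Rightarrow> nat \<Rightarrow> ('i \<Rightarrow> 'a::zero poly) \<times> ('i \<Rightarrow> 'a poly) \<times> 'a poly
    \<Rightarrow> ('i \<Rightarrow> 'a) \<times> ('i \<Rightarrow> 'a) \<times> 'a" where
  "lead_vec I P = (\<lambda>(x, y, z). (\<lambda>i\<in>I. coeff (x i) P, \<lambda>i\<in>I. coeff (y i) P, coeff z P))"

lemma coeff_mult_top:
  fixes p r :: "'a::comm_semiring_0 poly"
  assumes "p \<in> polys_lt (Suc P)" "r \<in> polys_lt (Suc P)"
  shows "coeff (p * r) (P + P) = coeff p P * coeff r P"
proof (cases "degree p = P \<and> degree r = P")
  case True
  then show ?thesis using coeff_mult_degree_sum[of p r] by simp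
next
  case False
  have le: "degree p \<le> P" "degree r \<le> P" using assms by (auto simp: polys_lt_Suc_iff)
  then have "degree (p * r) < P + P" using degree_mult_le[of p r] False by linarith
  then have "coeff (p * r) (P + P) = 0" by (rule coeff_eq_0)
  moreover have "coeff p P = 0 \<or> coeff r P = 0" using False le by (auto intro!: coeff_eq_0)
  ultimately show ?thesis by auto
qed

lemma polys_lt_mult_top:
  fixes p r :: "'a::comm_semiring_0 poly"
  assumes "p \<in> polys_lt (Suc P)" "r \<in> polys_lt (Suc P)"
  shows "p * r \<in> polys_lt (Suc (P + P))"
  using assms degree_mult_le[of p r] by (auto simp: polys_lt_Suc_iff)

text \<open>Compare the coefficients at \<open>t^(2P)\<close> in the equation.\<close>

lemma lead_vec_in_quadric_consts:
  assumes "t \<in> quadric_vectors a I (Suc P)"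
  shows "lead_vec I P t \<in> quadric_consts a I"
proof -
  obtain x y z where t: "t = (x, y, z)" by (cases t)
  have x: "x \<in> I \<rightarrow>\<^sub>E polys_lt (Suc P)" and y: "y \<in> I \<rightarrow>\<^sub>E polys_lt (Suc P)" and z: "z \<in> polys_lt (Suc P)"
    and f: "(\<Sum>i\<in>I. x i * y i) + smult a (z ^ 2) = 0"
    using assms by (auto simp: quadric_vectors_def t)
  have "coeff ((\<Sum>i\<in>I. x i * y i) + smult a (z ^ 2)) (P + P) = 0" by (simp add: f)
  moreover have "coeff (\<Sum>i\<in>I. x i * y i) (P + P) = (\<Sum>i\<in>I. coeff (x i) P * coeff (y i) P)"
    unfolding coeff_sum using x y by (intro sum.cong refl coeff_mult_top) auto
  ultimately show ?thesis
    using coeff_mult_top[OF z z] by (auto simp: t lead_vec_def quadric_consts_def power2_eq_square)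
qed

lemma lead_vec_zero_iff:
  fixes a :: "'a::field_gcd" and I :: "'i set"
  assumes "t \<in> quadric_vectors a I (Suc P)"
  shows "lead_vec I P t = (\<lambda>i\<in>I. 0, \<lambda>i\<in>I. 0, 0) \<longleftrightarrow> t \<in> quadric_vectors a I P"
proof -
  have *: "p \<in> polys_lt P \<longleftrightarrow> coeff p P = 0" if "p \<in> polys_lt (Suc P)" for p :: "'a poly"
  proof
    assume c: "coeff p P = 0"
    have "coeff p k = 0" if "P \<le> k" for k
      using c \<open>p \<in> polys_lt (Suc P)\<close> that by (cases "k = P") (auto simp: polys_lt_def)
    then show "p \<in> polys_lt P" by (simp add: polys_lt_def)
  qed (simp add: polys_lt_def)
  obtain x y z where t: "t = (x, y, z)" by (cases t)
  have "(\<lambda>i\<in>I. coeff (f i) P) = (\<lambda>i\<in>I. 0) \<longleftrightarrow> f \<in> I \<rightarrow>\<^sub>E polys_lt P"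
    if "f \<in> I \<rightarrow>\<^sub>E polys_lt (Suc P)" for f :: "'i \<Rightarrow> 'a poly"
    using that * by (auto simp: fun_eq_iff PiE_iff restrict_def)
  then show ?thesis using assms * by (simp add: t lead_vec_def quadric_vectors_def)
qed

text \<open>The zeros with leading vector \<open>(u, v, w)\<close>: \<open>x i = u i Q\<close>, the entries outside \<open>i\<close> are determined by their
  remainders modulo \<open>Q\<close>, and \<open>y i\<close> is forced by the equation, with the correct coefficient at \<open>t\<^sup>P\<close>
  because \<open>(u, v, w)\<close> is isotropic.\<close>

lemma card_quadric_vectors_lead:
  fixes a :: "'a::{finite,field_gcd}" and I :: "'i set"
  assumes fin: "finite I" and i: "i \<in> I" and uvw: "(u, v, w) \<in> quadric_consts a I" and ui: "u i \<noteq> 0"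
  shows "card {t \<in> quadric_vectors a I (Suc P). lead_vec I P t = (u, v, w)} =
           card (divisor_solutions a (I - {i}) P)"
proof -
  let ?K = "I - {i}"
  have ext: "u \<in> I \<rightarrow>\<^sub>E UNIV" "v \<in> I \<rightarrow>\<^sub>E UNIV" using uvw by (auto simp: quadric_consts_def)
  have rel: "(\<Sum>j\<in>?K. u j * v j) + a * w ^ 2 = - (u i * v i)"
    using uvw fin i by (simp add: quadric_consts_def sum.remove[of I i] eq_neg_iff_add_eq_0 add_ac)
  define lift where "lift = (\<lambda>c (Q::'a poly) p. p + smult c Q)"
  \<comment> \<open>A residue \<open>p\<close> is lifted to \<open>p + smult c Q\<close>, the only
    element of its class of degree at most \<open>P\<close> with coefficient \<open>c\<close> at
    \<open>t^P\<close>; the \<open>i\<close>-th pair is filled in by \<open>smult (u i) Q\<close>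
    and the solution of the equation.\<close>
  define F :: "('a poly \<times> ('i \<Rightarrow> 'a poly)) \<times> 'a poly \<times> ('i \<Rightarrow> 'a poly)
       \<Rightarrow> ('i \<Rightarrow> 'a poly) \<times> ('i \<Rightarrow> 'a poly) \<times> 'a poly" where
    "F = (\<lambda>((Q, x), z, y).
        let x' = (\<lambda>j. x j + smult (u j) Q); y' = (\<lambda>j. y j + smult (v j) Q); z' = z + smult w Q in
        (\<lambda>j\<in>I. if j = i then smult (u i) Q else x' j,
         \<lambda>j\<in>I. if j = i then - (((\<Sum>j\<in>?K. x' j * y' j) + smult a (z' ^ 2)) div smult (u i) Q) else y' j,
         z'))"
  \<comment> \<open>Going back, \<open>Q\<close> is \<open>x i\<close> made monic, and subtracting
    the multiples of \<open>Q\<close> returns the residues.\<close>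
  define G :: "('i \<Rightarrow> 'a poly) \<times> ('i \<Rightarrow> 'a poly) \<times> 'a poly
       \<Rightarrow> ('a poly \<times> ('i \<Rightarrow> 'a poly)) \<times> 'a poly \<times> ('i \<Rightarrow> 'a poly)" where
    "G = (\<lambda>(x, y, z). let Q = smult (inverse (u i)) (x i) in
        ((Q, \<lambda>j\<in>?K. x j - smult (u j) Q), z - smult w Q, \<lambda>j\<in>?K. y j - smult (v j) Q))"
  have up: "p + smult c Q \<in> polys_lt (Suc P)" "coeff (p + smult c Q) P = c"
    if "p \<in> polys_lt P" "Q \<in> monics P" for p Q :: "'a poly" and c
  proof -
    have "p \<in> polys_lt (Suc P)" using that polys_lt_mono[of P "Suc P"] by auto
    moreover have "Q \<in> polys_lt (Suc P)" using that by (auto simp: monics_def polys_lt_Suc_iff)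
    ultimately show "p + smult c Q \<in> polys_lt (Suc P)" by (intro polys_lt_add polys_lt_smult)
    show "coeff (p + smult c Q) P = c"
      using that by (simp add: monicsD polys_lt_def)
  qed
  have down: "p - smult c Q \<in> polys_lt P"
    if "p \<in> polys_lt (Suc P)" "Q \<in> monics P" "coeff p P = c" for p Q :: "'a poly" and c
    unfolding polys_lt_def
  proof safe
    fix k assume "P \<le> k"
    then show "coeff (p - smult c Q) k = 0"
      using that by (cases "k = P") (auto simp: monicsD polys_lt_def coeff_eq_0)
  qed
  \<comment> \<open>Lifting adds multiples of \<open>Q\<close>, so the value of the form in the
    remaining variables is unchanged modulo \<open>Q\<close>.\<close>
  have cong: "Q dvd (\<Sum>j\<in>?K. x j * y j) + smult a (z ^ 2) \<longleftrightarrow>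
      Q dvd (\<Sum>j\<in>?K. (x j + smult (u j) Q) * (y j + smult (v j) Q)) + smult a ((z + smult w Q) ^ 2)"
    for Q z :: "'a poly" and x y
  proof -
    have "(\<Sum>j\<in>?K. (x j + smult (u j) Q) * (y j + smult (v j) Q)) + smult a ((z + smult w Q) ^ 2) =
      ((\<Sum>j\<in>?K. x j * y j) + smult a (z ^ 2)) +
      Q * ((\<Sum>j\<in>?K. smult (v j) (x j) + smult (u j) (y j) + smult (u j * v j) Q)
        + (smult (a * w) z + smult (a * w) z) + smult (a * w * w) Q)"
      by (simp add: sum.distrib[symmetric] sum_distrib_left algebra_simps power2_eq_square
          smult_add_right)
    then show ?thesis by (simp only: dvd_add_left_iff[OF dvd_triv_left])
  qed
  have inverse: "G t \<in> divisor_solutions a ?K P \<and> F (G t) = t"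
    if "t \<in> {t \<in> quadric_vectors a I (Suc P). lead_vec I P t = (u, v, w)}" for t
  proof -
    from that obtain x y z where t: "t = (x, y, z)" and x: "x \<in> I \<rightarrow>\<^sub>E polys_lt (Suc P)"
      and y: "y \<in> I \<rightarrow>\<^sub>E polys_lt (Suc P)" and z: "z \<in> polys_lt (Suc P)"
      and f: "(\<Sum>i\<in>I. x i * y i) + smult a (z ^ 2) = 0" and l: "lead_vec I P t = (u, v, w)"
      by (cases t) (auto simp: quadric_vectors_def)
    have cx: "coeff (x j) P = u j" and cy: "coeff (y j) P = v j" if "j \<in> I" for j
      using l that by (auto simp: t lead_vec_def)
    have cz: "coeff z P = w" using l by (simp add: t lead_vec_def)
    define Q where "Q = smult (inverse (u i)) (x i)"
    have "degree (x i) = P"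
      using x i ui cx[OF i] le_degree[of "x i" P] by (auto simp: polys_lt_Suc_iff PiE_iff intro: antisym)
    then have Q: "Q \<in> monics P" using ui cx[OF i] by (simp add: Q_def monics_def)
    have xi: "x i = smult (u i) Q" using ui by (simp add: Q_def)
    have Gt: "G t = ((Q, \<lambda>j\<in>?K. x j - smult (u j) Q), z - smult w Q, \<lambda>j\<in>?K. y j - smult (v j) Q)"
      by (simp add: G_def t Q_def Let_def)
    have N: "(\<Sum>j\<in>?K. x j * y j) + smult a (z ^ 2) = - (smult (u i) Q * y i)"
    proof -
      have "(\<Sum>i\<in>I. x i * y i) = smult (u i) Q * y i + (\<Sum>j\<in>?K. x j * y j)"
        unfolding sum.remove[OF fin i, of "\<lambda>i. x i * y i"] xi[symmetric] by (rule refl)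
      then show ?thesis using f by (simp only: eq_neg_iff_add_eq_0 add_ac)
    qed
    have rs: "(\<Sum>j\<in>?K. ((\<lambda>j\<in>?K. x j - smult (u j) Q) j + smult (u j) Q) *
            ((\<lambda>j\<in>?K. y j - smult (v j) Q) j + smult (v j) Q)) = (\<Sum>j\<in>?K. x j * y j)"
      by (intro sum.cong refl) simp
    have "Q dvd smult (u i) Q * y i" by (intro dvd_mult2 dvd_smult dvd_refl)
    then have "Q dvd (\<Sum>j\<in>?K. x j * y j) + smult a (z ^ 2)"
      by (simp only: N dvd_minus_iff)
    then have "Q dvd (\<Sum>j\<in>?K. (\<lambda>j\<in>?K. x j - smult (u j) Q) j * (\<lambda>j\<in>?K. y j - smult (v j) Q) j)
        + smult a ((z - smult w Q) ^ 2)"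
      by - (rule cong[THEN iffD2], simp only: rs diff_add_cancel)
    moreover have "(\<lambda>j\<in>?K. x j - smult (u j) Q) \<in> ?K \<rightarrow>\<^sub>E polys_lt P"
      "(\<lambda>j\<in>?K. y j - smult (v j) Q) \<in> ?K \<rightarrow>\<^sub>E polys_lt P"
      using down[OF PiE_mem[OF x] Q cx] down[OF PiE_mem[OF y] Q cy] by auto
    ultimately have Gt_in: "G t \<in> divisor_solutions a ?K P"
      unfolding Gt divisor_solutions_def moduli_vectors_def using Q down[OF z Q cz] by blast
    have "F (G t) = (\<lambda>j\<in>I. if j = i then smult (u i) Q else x j,
         \<lambda>j\<in>I. if j = i then - (((\<Sum>j\<in>?K. x j * y j) + smult a (z ^ 2)) div smult (u i) Q) else y j, z)"
      unfolding Gt F_def Let_def prod.case rs by (auto simp: fun_eq_iff)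
    also have "- (((\<Sum>j\<in>?K. x j * y j) + smult a (z ^ 2)) div smult (u i) Q) = y i"
    proof -
      have "smult (u i) Q \<noteq> 0" using ui monicsD(1)[OF Q] by simp
      then show ?thesis unfolding N poly_div_minus_left minus_minus by (rule nonzero_mult_div_cancel_left)
    qed
    also have "(\<lambda>j\<in>I. if j = i then smult (u i) Q else x j, \<lambda>j\<in>I. if j = i then y i else y j, z) = t"
      using x y xi by (auto simp: t fun_eq_iff PiE_iff extensional_def)
    finally show ?thesis using Gt_in by blast
  qed
  have "bij_betw F (divisor_solutions a ?K P)
     {t \<in> quadric_vectors a I (Suc P). lead_vec I P t = (u, v, w)}"
  proof (rule bij_betwI[where g = G])
    show "F \<in> divisor_solutions a ?K P \<rightarrow> {t \<in> quadric_vectors a I (Suc P). lead_vec I P t = (u, v, w)}"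
    proof
      fix p assume "p \<in> divisor_solutions a ?K P"
      then obtain Q x z y where p: "p = ((Q, x), z, y)" and Q: "Q \<in> monics P"
        and x: "x \<in> ?K \<rightarrow>\<^sub>E polys_lt P" and y: "y \<in> ?K \<rightarrow>\<^sub>E polys_lt P" and z: "z \<in> polys_lt P"
        and dv: "Q dvd (\<Sum>j\<in>?K. x j * y j) + smult a (z ^ 2)"
        by (auto simp: divisor_solutions_def moduli_vectors_def)
      define x' where "x' = (\<lambda>j. x j + smult (u j) Q)"
      define y' where "y' = (\<lambda>j. y j + smult (v j) Q)"
      define z' where "z' = z + smult w Q"
      define N where "N = (\<Sum>j\<in>?K. x' j * y' j) + smult a (z' ^ 2)"
      define yi where "yi = - (N div smult (u i) Q)"
      have x': "x' j \<in> polys_lt (Suc P)" "coeff (x' j) P = u j" if "j \<in> ?K" for j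
        unfolding x'_def using up[OF PiE_mem[OF x that] Q] by blast+
      have y': "y' j \<in> polys_lt (Suc P)" "coeff (y' j) P = v j" if "j \<in> ?K" for j
        unfolding y'_def using up[OF PiE_mem[OF y that] Q] by blast+
      have z': "z' \<in> polys_lt (Suc P)" "coeff z' P = w" unfolding z'_def using up[OF z Q] by blast+
      have NP: "N \<in> polys_lt (Suc (P + P))"
        unfolding N_def power2_eq_square using x' y' z'
        by (intro polys_lt_add polys_lt_sum polys_lt_smult polys_lt_mult_top) auto
      have "coeff (\<Sum>j\<in>?K. x' j * y' j) (P + P) = (\<Sum>j\<in>?K. u j * v j)"
        unfolding coeff_sum using x' y' by (intro sum.cong refl) (simp add: coeff_mult_top)
      then have Nc: "coeff N (P + P) = - (u i * v i)"
        using coeff_mult_top[OF z'(1) z'(1)] z'(2) by (simp add: N_def rel[symmetric] power2_eq_square)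
      have "Q dvd N" using dv cong[of Q x y z] by (simp add: N_def x'_def y'_def z'_def)
      then have "smult (u i) Q dvd N" using ui by (simp add: smult_dvd_iff)
      then have N: "smult (u i) Q * yi = - N"
        unfolding yi_def by (simp only: mult_minus_right dvd_mult_div_cancel)
      have dQ: "smult (u i) Q \<noteq> 0" "degree (smult (u i) Q) = P" "coeff (smult (u i) Q) P = u i"
        using ui Q by (auto simp: monicsD)
      have sQ: "smult (u i) Q \<in> polys_lt (Suc P)" using dQ(2) by (simp only: polys_lt_Suc_iff order_refl)
      \<comment> \<open>\<open>N\<close> has degree at most \<open>2P\<close> and
        \<open>smult (u i) Q\<close> has degree exactly \<open>P\<close>, which leaves at most
        \<open>P\<close> for the quotient.\<close>
      have yi: "yi \<in> polys_lt (Suc P)"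
      proof (cases "yi = 0")
        case False
        then have "P + degree yi = degree N"
          using degree_mult_eq[OF dQ(1) False] unfolding N dQ(2) by simp
        then show ?thesis using NP by (simp add: polys_lt_Suc_iff)
      qed simp
      have "u i * coeff yi P = u i * v i"
        using coeff_mult_top[OF sQ yi] unfolding N dQ(3) coeff_minus Nc minus_minus by (rule sym)
      then have yic: "coeff yi P = v i" using ui by simp
      have Fp: "F p = (\<lambda>j\<in>I. if j = i then smult (u i) Q else x' j, \<lambda>j\<in>I. if j = i then yi else y' j, z')"
        unfolding F_def p Let_def prod.case x'_def y'_def z'_def N_def yi_def by (rule refl)
      have "(\<Sum>j\<in>I. (\<lambda>j\<in>I. if j = i then smult (u i) Q else x' j) j * (\<lambda>j\<in>I. if j = i then yi else y' j) j)
          = smult (u i) Q * yi + (\<Sum>j\<in>?K. x' j * y' j)"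
        using fin i by (subst sum.remove[of I i]) (auto intro!: sum.cong)
      moreover have "smult (u i) Q * yi + (\<Sum>j\<in>?K. x' j * y' j) + smult a (z' ^ 2) = 0"
        using N unfolding N_def by (simp only: eq_neg_iff_add_eq_0 add.assoc)
      moreover have "(\<lambda>j\<in>I. if j = i then smult (u i) Q else x' j) \<in> I \<rightarrow>\<^sub>E polys_lt (Suc P)"
        "(\<lambda>j\<in>I. if j = i then yi else y' j) \<in> I \<rightarrow>\<^sub>E polys_lt (Suc P)"
        using x'(1) y'(1) yi sQ by auto
      ultimately have "F p \<in> quadric_vectors a I (Suc P)"
        unfolding Fp quadric_vectors_def using z'(1) by (simp del: mult_smult_left)
      moreover have "lead_vec I P (F p) = (u, v, w)"
      proof -
        have "(\<lambda>j\<in>I. coeff ((\<lambda>j\<in>I. if j = i then smult (u i) Q else x' j) j) P) = u"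
          "(\<lambda>j\<in>I. coeff ((\<lambda>j\<in>I. if j = i then yi else y' j) j) P) = v"
          using x'(2) y'(2) yic dQ(3) ext by (auto simp: fun_eq_iff PiE_iff extensional_def)
        then show ?thesis unfolding Fp lead_vec_def using z'(2) by simp
      qed
      ultimately show "F p \<in> {t \<in> quadric_vectors a I (Suc P). lead_vec I P t = (u, v, w)}" by simp
    qed
  next
    show "G \<in> {t \<in> quadric_vectors a I (Suc P). lead_vec I P t = (u, v, w)} \<rightarrow> divisor_solutions a ?K P"
      using inverse by blast
  next
    fix t assume "t \<in> {t \<in> quadric_vectors a I (Suc P). lead_vec I P t = (u, v, w)}"
    then show "F (G t) = t" using inverse by blast
  next
    fix p assume "p \<in> divisor_solutions a ?K P"
    then obtain Q x z y where p: "p = ((Q, x), z, y)"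
      and x: "x \<in> ?K \<rightarrow>\<^sub>E polys_lt P" and y: "y \<in> ?K \<rightarrow>\<^sub>E polys_lt P"
      by (auto simp: divisor_solutions_def moduli_vectors_def)
    show "G (F p) = p"
      using x y ui i by (auto simp: p F_def G_def Let_def fun_eq_iff PiE_iff extensional_def mult.assoc)
  qed
  from bij_betw_same_card[OF this] show ?thesis by simp
qed

lemma finite_quadric_vectors:
  fixes a :: "'a::{finite,field_gcd}"
  assumes "finite I"
  shows "finite (quadric_vectors a I d)"
proof (rule finite_subset)
  show "quadric_vectors a I d \<subseteq> (I \<rightarrow>\<^sub>E polys_lt d) \<times> (I \<rightarrow>\<^sub>E polys_lt d) \<times> polys_lt d"
    by (auto simp: quadric_vectors_def)
qed (use assms in \<open>auto intro!: finite_PiE finite_cartesian_product\<close>)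

lemma finite_quadric_consts:
  fixes a :: "'a::{finite,field_gcd}"
  assumes "finite I"
  shows "finite (quadric_consts a I)"
proof (rule finite_subset)
  show "quadric_consts a I \<subseteq> (I \<rightarrow>\<^sub>E UNIV) \<times> (I \<rightarrow>\<^sub>E UNIV) \<times> UNIV"
    by (auto simp: quadric_consts_def)
qed (use assms in \<open>auto intro!: finite_PiE finite_cartesian_product\<close>)

text \<open>Exchanging the two halves of all hyperbolic pairs preserves the form, so a nonzero
  \<open>v i\<close> serves as well as a nonzero \<open>u i\<close>.\<close>

lemma card_quadric_vectors_lead_swap:
  "card {t \<in> quadric_vectors a I (Suc P). lead_vec I P t = (u, v, w)} =
   card {t \<in> quadric_vectors a I (Suc P). lead_vec I P t = (v, u, w)}"
proof -
  have "bij_betw (\<lambda>(x, y, z). (y, x, z))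
      {t \<in> quadric_vectors a I (Suc P). lead_vec I P t = (u, v, w)}
      {t \<in> quadric_vectors a I (Suc P). lead_vec I P t = (v, u, w)}"
    by (rule bij_betwI[where g = "\<lambda>(x, y, z). (y, x, z)"])
       (auto simp: quadric_vectors_def lead_vec_def mult.commute)
  then show ?thesis by (rule bij_betw_same_card)
qed

text \<open>Partition by leading vector: the zero vector accounts for
  \<open>quadric_vectors a I P\<close>, and all other fibres have the same size. The index
  \<open>i0\<close> only represents the common size \<open>card I - 1\<close>.\<close>

lemma card_quadric_vectors_diff:
  fixes a :: "'a::{finite,field_gcd}" and I :: "'i set"
  assumes fin: "finite I" and i0: "i0 \<in> I" and a0: "a \<noteq> 0"
  shows "card (quadric_vectors a I (Suc P) - quadric_vectors a I P) =
    (card (quadric_consts a I) - 1) * card (divisor_solutions a (I - {i0}) P)"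
proof -
  let ?zero = "(\<lambda>i\<in>I. 0, \<lambda>i\<in>I. 0, 0) :: ('i \<Rightarrow> 'a) \<times> ('i \<Rightarrow> 'a) \<times> 'a"
  let ?U = "quadric_consts a I - {?zero}"
  let ?fib = "\<lambda>s. {t \<in> quadric_vectors a I (Suc P). lead_vec I P t = s}"
  have sub: "quadric_vectors a I P \<subseteq> quadric_vectors a I (Suc P)"
    using polys_lt_mono[of P "Suc P"] by (fastforce simp: quadric_vectors_def)
  have "quadric_vectors a I (Suc P) - quadric_vectors a I P = (\<Union>s\<in>?U. ?fib s)"
    using lead_vec_in_quadric_consts[of _ a I P] lead_vec_zero_iff[of _ a I P] sub by blast
  then have "card (quadric_vectors a I (Suc P) - quadric_vectors a I P) = (\<Sum>s\<in>?U. card (?fib s))"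
    using finite_quadric_vectors[OF fin, of a "Suc P"] finite_quadric_consts[OF fin, of a]
    by (simp only:) (intro card_UN_disjoint, auto)
  also have "\<dots> = (\<Sum>s\<in>?U. card (divisor_solutions a (I - {i0}) P))"
  proof (intro sum.cong refl)
    fix s assume s: "s \<in> ?U"
    obtain u v w where uvw: "s = (u, v, w)" by (cases s)
    have q: "u \<in> I \<rightarrow>\<^sub>E UNIV" "v \<in> I \<rightarrow>\<^sub>E UNIV" "(\<Sum>i\<in>I. u i * v i) + a * w ^ 2 = 0"
      using s by (auto simp: uvw quadric_consts_def)
    have swap: "(v, u, w) \<in> quadric_consts a I" using q by (simp add: quadric_consts_def mult.commute)
    have card: "card (divisor_solutions a (I - {i}) P) = card (divisor_solutions a (I - {i0}) P)" if "i \<in> I" for i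
      using fin i0 a0 that by (intro card_divisor_solutions_cong) auto
    \<comment> \<open>If all hyperbolic coordinates vanish, isotropy reads
      \<open>a * w ^ 2 = 0\<close> and forces the zero vector.\<close>
    have "\<exists>i\<in>I. u i \<noteq> 0 \<or> v i \<noteq> 0"
    proof (rule ccontr)
      assume "\<not> ?thesis"
      then have uv: "u i = 0" "v i = 0" if "i \<in> I" for i using that by auto
      then have "w = 0" using q(3) a0 by simp
      moreover have "u = (\<lambda>i\<in>I. 0)" "v = (\<lambda>i\<in>I. 0)"
        using uv q(1,2) by (auto simp: fun_eq_iff PiE_iff extensional_def)
      ultimately show False using s uvw by auto
    qed
    then obtain i where i: "i \<in> I" "u i \<noteq> 0 \<or> v i \<noteq> 0" by blast
    show "card (?fib s) = card (divisor_solutions a (I - {i0}) P)"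
    proof (cases "u i = 0")
      case False
      then show ?thesis
        using card_quadric_vectors_lead[where u = u and v = v and w = w and a = a and P = P, OF fin i(1) _ False]
          s card[OF i(1)] by (simp add: uvw)
    next
      case True
      then have "v i \<noteq> 0" using i by simp
      then show ?thesis
        using card_quadric_vectors_lead[where P = P, OF fin i(1) swap] card[OF i(1)]
        by (simp add: uvw card_quadric_vectors_lead_swap[of a I P u])
    qed
  qed
  also have "\<dots> = (card (quadric_consts a I) - 1) * card (divisor_solutions a (I - {i0}) P)"
  proof -
    have "?zero \<in> quadric_consts a I" by (simp add: quadric_consts_def)
    then show ?thesis using finite_quadric_consts[OF fin, of a] by (simp add: card_Diff_singleton)
  qed
  finally show ?thesis .
qed

lemma polys_lt_Suc_0: "polys_lt (Suc 0) = range (\<lambda>c. [:c:])"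
  by (auto simp: polys_lt_Suc_iff) (metis degree_eq_zeroE rangeI)

text \<open>A linear modulus divides a constant only if the constant vanishes, so the zeros in \<open>F\<^sub>q\<close> can be read off
  from the count for moduli of degree one.\<close>

lemma card_quadric_consts:
  fixes a :: "'a::{finite,field_gcd}" and I :: "'i set"
  assumes fin: "finite I" and a0: "a \<noteq> 0"
  shows "card (quadric_consts a I) = CARD('a) ^ (2 * card I)"
proof -
  let ?M = "monics (Suc 0) :: 'a poly set"
  let ?f = "\<lambda>(Q :: 'a poly, u, v, w). ((Q, \<lambda>i\<in>I. [:u i:]), [:w:], \<lambda>i\<in>I. [:v i:])"
  let ?g = "\<lambda>((Q :: 'a poly, x), z, y). (Q, \<lambda>i\<in>I. coeff (x i) 0, \<lambda>i\<in>I. coeff (y i) 0, coeff z 0)"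
  have c: "(\<Sum>i\<in>I. [:u i:] * [:v i:]) + smult a ([:w:] ^ 2) = [:(\<Sum>i\<in>I. u i * v i) + a * w ^ 2:]"
    for u v :: "'i \<Rightarrow> 'a" and w
    by (simp add: power2_eq_square sum_to_poly mult.commute)
  have dv: "Q dvd [:c:] \<longleftrightarrow> c = 0" if "Q \<in> monics (Suc 0)" for Q :: "'a poly" and c
  proof
    assume "Q dvd [:c:]"
    moreover have "[:c:] \<in> polys_lt (Suc 0)" by (auto simp: polys_lt_Suc_iff)
    ultimately have "[:c:] = 0" using polys_lt_dvd_eq_0[OF that] by blast
    then show "c = 0" by simp
  qed simp
  have const: "[:coeff p 0:] = p" if "p \<in> polys_lt (Suc 0)" for p :: "'a poly"
    using that by (auto simp: polys_lt_Suc_0)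
  have "bij_betw ?f (?M \<times> quadric_consts a I) (divisor_solutions a I (Suc 0))"
  proof (rule bij_betwI[where g = ?g])
    show "?f \<in> ?M \<times> quadric_consts a I \<rightarrow> divisor_solutions a I (Suc 0)"
    proof
      fix s assume "s \<in> ?M \<times> quadric_consts a I"
      then obtain Q u v w where s: "s = (Q, u, v, w)" "Q \<in> monics (Suc 0)"
        "(\<Sum>i\<in>I. u i * v i) + a * w ^ 2 = 0" by (auto simp: quadric_consts_def)
      define U where "U = (\<lambda>i\<in>I. [:u i:])"
      define V where "V = (\<lambda>i\<in>I. [:v i:])"
      have "(\<Sum>i\<in>I. U i * V i) = (\<Sum>i\<in>I. [:u i:] * [:v i:])"
        unfolding U_def V_def by (intro sum.cong) auto
      then have UV: "(\<Sum>i\<in>I. U i * V i) + smult a ([:w:] ^ 2) = 0"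
        by (simp only: c s(3) pCons_0_0)
      have "U \<in> I \<rightarrow>\<^sub>E polys_lt (Suc 0)" "V \<in> I \<rightarrow>\<^sub>E polys_lt (Suc 0)" "[:w:] \<in> polys_lt (Suc 0)"
        by (auto simp: U_def V_def polys_lt_Suc_0)
      then have "((Q, U), [:w:], V) \<in> divisor_solutions a I (Suc 0)"
        using s(2) UV unfolding divisor_solutions_def moduli_vectors_def
        by (simp only: mem_Collect_eq prod.case mem_Times_iff fst_conv snd_conv dvd_0_right simp_thms)
      then show "?f s \<in> divisor_solutions a I (Suc 0)" by (simp add: s(1) U_def V_def)
    qed
    show "?g \<in> divisor_solutions a I (Suc 0) \<rightarrow> ?M \<times> quadric_consts a I"
    proof
      fix s assume "s \<in> divisor_solutions a I (Suc 0)"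
      then obtain Q x z y where s: "s = ((Q, x), z, y)" and Q: "Q \<in> monics (Suc 0)"
        and m: "x \<in> I \<rightarrow>\<^sub>E polys_lt (Suc 0)" "y \<in> I \<rightarrow>\<^sub>E polys_lt (Suc 0)" "z \<in> polys_lt (Suc 0)"
        and d: "Q dvd (\<Sum>i\<in>I. x i * y i) + smult a (z ^ 2)"
        by (auto simp: divisor_solutions_def moduli_vectors_def)
      have "(\<Sum>i\<in>I. x i * y i) + smult a (z ^ 2) =
          (\<Sum>i\<in>I. [:coeff (x i) 0:] * [:coeff (y i) 0:]) + smult a ([:coeff z 0:] ^ 2)"
      proof -
        have "(\<Sum>i\<in>I. x i * y i) = (\<Sum>i\<in>I. [:coeff (x i) 0:] * [:coeff (y i) 0:])"
          by (intro sum.cong refl) (simp only: const PiE_mem[OF m(1)] PiE_mem[OF m(2)])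
        then show ?thesis by (simp only: const m(3))
      qed
      then have "(\<Sum>i\<in>I. coeff (x i) 0 * coeff (y i) 0) + a * coeff z 0 ^ 2 = 0"
        using d dv[OF Q] by (simp only: c)
      then show "?g s \<in> ?M \<times> quadric_consts a I"
        using Q by (simp add: s quadric_consts_def)
    qed
  next
    fix s assume "s \<in> ?M \<times> quadric_consts a I"
    then show "?g (?f s) = s"
      by (auto simp: quadric_consts_def fun_eq_iff PiE_iff extensional_def)
  next
    fix s assume "s \<in> divisor_solutions a I (Suc 0)"
    then show "?f (?g s) = s"
      using const by (auto simp: divisor_solutions_def moduli_vectors_def fun_eq_iff PiE_iff extensional_def)
  qed
  from bij_betw_same_card[OF this]
  have "CARD('a) * card (quadric_consts a I) = card (divisor_solutions a I (Suc 0))"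
    by (simp add: card_cartesian_product card_monics)
  \<comment> \<open>There are \<open>q\<close> monic moduli of degree one, so one factor of
    \<open>q ^ (2 * card I + 1)\<close> is accounted for by the choice of \<open>Q\<close>.\<close>
  then have "real (CARD('a) * card (quadric_consts a I)) = real (CARD('a) ^ (2 * card I + 1))"
    using card_divisor_solutions_diff(3)[OF fin a0] by simp
  then have "CARD('a) * card (quadric_consts a I) = CARD('a) * CARD('a) ^ (2 * card I)"
    by (simp only: of_nat_eq_iff) simp
  then show ?thesis by simp
qed

section \<open>Diagonal and split forms\<close>

text \<open>Translation by one permutes the field; comparing the sums of all elements gives
  \<open>of_nat CARD('a) = 0\<close>. If also \<open>2 = 0\<close>, an odd cardinality would turn
  this into \<open>1 = 0\<close>.\<close>

lemma two_neq_zero_if_odd_card: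
  assumes "odd CARD('a::{finite,field})"
  shows "(2 :: 'a) \<noteq> 0"
proof
  assume two: "(2 :: 'a) = 0"
  have "bij (\<lambda>x::'a. x + 1)" by (rule bij_plus_right)
  then have "(\<Sum>x\<in>UNIV. x) = (\<Sum>x\<in>UNIV. x + (1::'a))"
    by (rule sum.reindex_bij_betw[where g = "\<lambda>x. x", symmetric])
  then have "of_nat CARD('a) = (0 :: 'a)" by (simp add: sum.distrib)
  moreover obtain k where "CARD('a) = 2 * k + 1" using assms by (elim oddE)
  ultimately show False using two by simp
qed

text \<open>The fibres of squaring have at most two elements, and the fibre over zero has only
  one.\<close>

lemma card_squares:
  shows "CARD('a::{finite,field}) + 1 \<le> 2 * card (range (\<lambda>x::'a. x ^ 2))"
proof -
  let ?S = "range (\<lambda>x::'a. x ^ 2)"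
  have fib: "card {x. x ^ 2 = y} \<le> 2" for y :: 'a
  proof (cases "\<exists>r. r ^ 2 = y")
    case True
    then obtain r where "r ^ 2 = y" by blast
    then have "{x. x ^ 2 = y} \<subseteq> {r, - r}" by (auto simp: power2_eq_iff)
    then have "card {x. x ^ 2 = y} \<le> card {r, - r}" by (intro card_mono) auto
    also have "\<dots> \<le> 2" by (simp add: card_insert_if)
    finally show ?thesis .
  qed simp
  have "UNIV = (\<Union>y\<in>?S. {x. x ^ 2 = y})" by auto
  then have "CARD('a) = card (\<Union>y\<in>?S. {x. x ^ 2 = y})" by (rule arg_cong)
  also have "\<dots> = (\<Sum>y\<in>?S. card {x. x ^ 2 = y})" by (intro card_UN_disjoint) auto
  also have "\<dots> = card {x::'a. x ^ 2 = 0} + (\<Sum>y\<in>?S - {0}. card {x. x ^ 2 = y})"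
    by (intro sum.remove) (auto intro: range_eqI[of _ _ 0])
  also have "\<dots> \<le> 1 + (\<Sum>y\<in>?S - {0}. 2)"
    by (intro add_mono sum_mono fib) simp
  also have "\<dots> = 1 + 2 * (card ?S - 1)"
    by (subst sum_constant, subst card_Diff_singleton) (auto intro: range_eqI[of _ _ 0])
  finally have "CARD('a) \<le> 1 + 2 * (card ?S - 1)" .
  moreover have "card ?S > 0" by (simp add: card_gt_0_iff)
  ultimately show ?thesis by linarith
qed

text \<open>Pigeonhole: the values of \<open>a * r ^ 2\<close> and those of
  \<open>c - b * s ^ 2\<close> each fill more than half of the field, so they meet.\<close>

lemma binary_form_universal:
  fixes a b c :: "'a::{finite,field}"
  assumes "a \<noteq> 0" "b \<noteq> 0"
  obtains r s where "a * r ^ 2 + b * s ^ 2 = c"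
proof -
  let ?S = "range (\<lambda>x::'a. x ^ 2)"
  have inj: "inj_on (\<lambda>y. a * y) ?S" "inj_on (\<lambda>y. c - b * y) ?S"
    using assms by (auto simp: inj_on_def)
  have "(\<lambda>y. a * y) ` ?S \<inter> (\<lambda>y. c - b * y) ` ?S \<noteq> {}"
  proof
    assume "(\<lambda>y. a * y) ` ?S \<inter> (\<lambda>y. c - b * y) ` ?S = {}"
    then have "card ((\<lambda>y. a * y) ` ?S \<union> (\<lambda>y. c - b * y) ` ?S) = card ?S + card ?S"
      using inj by (subst card_Un_disjoint) (simp_all only: card_image finite)
    moreover have "card ((\<lambda>y. a * y) ` ?S \<union> (\<lambda>y. c - b * y) ` ?S) \<le> CARD('a)"
      by (rule card_mono) auto
    ultimately show False using card_squares[where 'a='a] by linarith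
  qed
  then obtain r s where "a * r ^ 2 = c - b * s ^ 2" by blast
  then show ?thesis using that[of r s] by (simp add: algebra_simps)
qed

section \<open>Symmetric bilinear forms and orthogonal bases\<close>

definition bform :: "'a::comm_ring_1^'n^'n \<Rightarrow> 'a^'n \<Rightarrow> 'a^'n \<Rightarrow> 'a" where
  "bform A x y = (\<Sum>i\<in>UNIV. \<Sum>j\<in>UNIV. A $ i $ j * x $ i * y $ j)"

lemma bform_add: "bform A (x + y) z = bform A x z + bform A y z"
    "bform A z (x + y) = bform A z x + bform A z y"
  by (simp_all add: bform_def algebra_simps sum.distrib)

lemma bform_scale: "bform A (c *s x) y = c * bform A x y" "bform A x (c *s y) = c * bform A x y"
  by (simp_all add: bform_def sum_distrib_left mult_ac)

lemma bform_sum: "bform A (\<Sum>k\<in>S. f k) z = (\<Sum>k\<in>S. bform A (f k) z)"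
  by (induction S rule: infinite_finite_induct) (simp_all add: bform_add, simp_all add: bform_def)

lemma bform_diff: "bform A (x - y) z = bform A x z - bform A y z"
  by (simp add: bform_def algebra_simps sum_subtractf)

lemma bform_sym: "transpose A = A \<Longrightarrow> bform A x y = bform A y x"
proof -
  assume "transpose A = A"
  from arg_cong[OF this, of "\<lambda>M. M $ j $ i" for i j]
  have sym: "A $ i $ j = A $ j $ i" for i j by (simp add: transpose_def)
  have "A $ j $ i * x $ j * y $ i = A $ i $ j * y $ i * x $ j" for i j
    by (simp add: sym[of j i] mult_ac)
  then show ?thesis unfolding bform_def by (subst sum.swap) (simp only:)
qed

lemma bform_nondegenerate:
  fixes A :: "'a::field^'n^'n"
  assumes "det A \<noteq> 0" "w \<noteq> 0" "transpose A = A"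
  obtains y where "bform A w y \<noteq> 0"
proof -
  have "A *v w \<noteq> 0"
  proof
    assume "A *v w = 0"
    moreover obtain B where "B ** A = mat 1"
      using assms(1) invertible_det_nz[of A] by (auto simp: invertible_def)
    then have "w = B *v (A *v w)" by (simp add: matrix_vector_mul_assoc)
    ultimately show False using \<open>w \<noteq> 0\<close> by simp
  qed
  then obtain i where i: "(A *v w) $ i \<noteq> 0" by (auto simp: vec_eq_iff)
  have "bform A (axis i 1) w = (\<Sum>k\<in>UNIV. if k = i then (\<Sum>j\<in>UNIV. A $ i $ j * w $ j) else 0)"
    unfolding bform_def by (intro sum.cong refl) (auto simp: axis_def)
  then have "bform A (axis i 1) w = (A *v w) $ i" by (simp add: matrix_vector_mult_def)
  then have "bform A w (axis i 1) \<noteq> 0" using i bform_sym[OF assms(3)] by simp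
  then show ?thesis using that by blast
qed

text \<open>A vector orthogonal to the given family exists because the map to its coordinate functionals is not
  injective for reasons of cardinality.\<close>

lemma orthogonal_family_exists:
  fixes A :: "'a::{finite,field}^'n^'n" and S :: "'n set"
  assumes det: "det A \<noteq> 0" and sym: "transpose A = A" and two: "(2::'a) \<noteq> 0"
  shows "\<exists>v. \<forall>i\<in>S. \<forall>j\<in>S. (bform A (v i) (v j) = 0) \<longleftrightarrow> i \<noteq> j"
  using finite[of S]
proof (induction S rule: finite_induct)
  case (insert k S)
  then obtain v where v: "\<And>i j. i \<in> S \<Longrightarrow> j \<in> S \<Longrightarrow> bform A (v i) (v j) = 0 \<longleftrightarrow> i \<noteq> j" by blast
  have "card S < CARD('n)" using insert.hyps psubset_card_mono[of UNIV S] by auto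
  moreover have "CARD('a) > 1" using card_mono[of "UNIV :: 'a set" "{0, 1}"] by simp
  ultimately have "card (S \<rightarrow>\<^sub>E (UNIV :: 'a set)) < CARD('a^'n)"
    by (simp add: card_PiE power_strict_increasing)
  then have "\<not> inj (\<lambda>x. \<lambda>i\<in>S. bform A x (v i))"
    using card_inj_on_le[of "\<lambda>x. \<lambda>i\<in>S. bform A x (v i)" UNIV "S \<rightarrow>\<^sub>E UNIV"] finite_PiE[of S "\<lambda>_. UNIV :: 'a set"]
    by (force simp: linorder_not_less[symmetric])
  then obtain x1 x2 where x12: "x1 \<noteq> x2" "(\<lambda>i\<in>S. bform A x1 (v i)) = (\<lambda>i\<in>S. bform A x2 (v i))"
    by (auto simp: inj_def)
  define w where "w = x1 - x2"
  have w0: "w \<noteq> 0" using x12 by (simp add: w_def)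
  have w: "bform A w (v i) = 0" if "i \<in> S" for i
    using fun_cong[OF x12(2), of i] that by (simp add: w_def bform_diff)
  obtain y0 where y0: "bform A w y0 \<noteq> 0" using bform_nondegenerate[OF det w0 sym] .
  \<comment> \<open>The projection of \<open>y0\<close> to the span of the family. Subtracting it
    makes \<open>y\<close> orthogonal to the family, while the pairing with \<open>w\<close> is kept
    because \<open>w\<close> is orthogonal to the span.\<close>
  define p where "p = (\<Sum>i\<in>S. (bform A y0 (v i) / bform A (v i) (v i)) *s v i)"
  define y where "y = y0 - p"
  have "bform A p (v j) = bform A y0 (v j)" if "j \<in> S" for j
  proof -
    have "bform A p (v j) = (\<Sum>i\<in>S. if i = j then bform A y0 (v j) else 0)"
      unfolding p_def bform_sum bform_scale using v[OF _ that] that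
      by (intro sum.cong refl) auto
    then show ?thesis using that insert.hyps by simp
  qed
  then have y: "bform A y (v j) = 0" if "j \<in> S" for j using that by (simp add: y_def bform_diff)
  have "bform A p w = 0"
    unfolding p_def bform_sum bform_scale by (simp add: w bform_sym[OF sym, of "v _" w])
  then have wy: "bform A y w \<noteq> 0" using y0 bform_sym[OF sym, of w y0] by (simp add: y_def bform_diff)
  \<comment> \<open>One of \<open>w\<close>, \<open>y\<close> and \<open>w + y\<close> is
    anisotropic: if the first two are isotropic, the form takes the value
    \<open>2 * bform A y w\<close> at \<open>w + y\<close>.\<close>
  obtain e where e: "bform A e e \<noteq> 0" "\<And>i. i \<in> S \<Longrightarrow> bform A e (v i) = 0"
  proof (cases "bform A w w = 0 \<and> bform A y y = 0")
    case True
    have "bform A (w + y) (w + y) = 2 * bform A y w"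
      using True bform_sym[OF sym, of w y] by (simp add: bform_add)
    then have "bform A (w + y) (w + y) \<noteq> 0" using wy two by simp
    moreover have "bform A (w + y) (v i) = 0" if "i \<in> S" for i using that w y by (simp add: bform_add)
    ultimately show ?thesis using that by blast
  qed (use that w y in blast)
  have e': "bform A (v i) e = 0" if "i \<in> S" for i using e(2)[OF that] bform_sym[OF sym, of e "v i"] by simp
  have "(bform A ((v(k := e)) i) ((v(k := e)) j) = 0) \<longleftrightarrow> i \<noteq> j"
    if "i \<in> insert k S" "j \<in> insert k S" for i j
    using that v e e' insert.hyps(2) by (cases "i = k"; cases "j = k") auto
  then show ?case by blast
qed simp

text \<open>A bijective substitution that respects every degree bound in both directions, as needed
  to transport counts of zeros of bounded degree.\<close>

definition form_equiv :: "(('n \<Rightarrow> 'a::field poly) \<Rightarrow> 'a poly) \<Rightarrow> (('n \<Rightarrow> 'a poly) \<Rightarrow> 'a poly) \<Rightarrow> bool" where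
  "form_equiv F G \<longleftrightarrow> (\<exists>T T'. (\<forall>x. T (T' x) = x) \<and> (\<forall>x. T' (T x) = x) \<and> (\<forall>x. F (T x) = G x) \<and>
     (\<forall>d x. range x \<subseteq> polys_lt d \<longrightarrow> range (T x) \<subseteq> polys_lt d \<and> range (T' x) \<subseteq> polys_lt d))"

lemma form_equiv_refl: "form_equiv F F"
  unfolding form_equiv_def by (intro exI[of _ id]) auto

lemma form_equiv_trans:
  assumes "form_equiv F G" "form_equiv G H"
  shows "form_equiv F H"
proof -
  obtain T T' where 1: "\<And>x. T (T' x) = x" "\<And>x. T' (T x) = x" "\<And>x. F (T x) = G x"
    "\<And>d x. range x \<subseteq> polys_lt d \<Longrightarrow> range (T x) \<subseteq> polys_lt d \<and> range (T' x) \<subseteq> polys_lt d"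
    using assms(1) unfolding form_equiv_def by blast
  obtain U U' where 2: "\<And>x. U (U' x) = x" "\<And>x. U' (U x) = x" "\<And>x. G (U x) = H x"
    "\<And>d x. range x \<subseteq> polys_lt d \<Longrightarrow> range (U x) \<subseteq> polys_lt d \<and> range (U' x) \<subseteq> polys_lt d"
    using assms(2) unfolding form_equiv_def by blast
  show ?thesis
    unfolding form_equiv_def
    by (intro exI[of _ "T \<circ> U"] exI[of _ "U' \<circ> T'"]) (use 1 2 in \<open>simp add: o_def\<close>)
qed

lemma card_zeros_form_equiv:
  assumes "form_equiv F G"
  shows "card {x. range x \<subseteq> polys_lt d \<and> F x = 0} = card {x. range x \<subseteq> polys_lt d \<and> G x = 0}"
proof -
  obtain T T' where 1: "\<And>x. T (T' x) = x" "\<And>x. T' (T x) = x" "\<And>x. F (T x) = G x"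
    "\<And>d x. range x \<subseteq> polys_lt d \<Longrightarrow> range (T x) \<subseteq> polys_lt d \<and> range (T' x) \<subseteq> polys_lt d"
    using assms(1) unfolding form_equiv_def by blast
  have "F x = G (T' x)" for x using 1(1,3) by metis
  then have "bij_betw T {x. range x \<subseteq> polys_lt d \<and> G x = 0} {x. range x \<subseteq> polys_lt d \<and> F x = 0}"
    using 1 by (intro bij_betwI[where g = T']) auto
  then show ?thesis by (rule bij_betw_same_card[symmetric])
qed

lemma smult_sum_right: "smult a (sum f S) = (\<Sum>i\<in>S. smult a (f i))"
  by (induction S rule: infinite_finite_induct) (simp_all add: smult_add_right)

lemma form_equiv_diagonal:
  fixes A :: "'a::{finite,field}^'n^'n"
  assumes "det A \<noteq> 0" "transpose A = A" "(2::'a) \<noteq> 0"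
  shows "\<exists>a. (\<forall>i. a i \<noteq> 0) \<and>
    form_equiv (\<lambda>x. qf_eval A (\<chi> i. x i)) (\<lambda>x. \<Sum>i\<in>UNIV. smult (a i) (x i ^ 2))"
proof -
  obtain v :: "'n \<Rightarrow> 'a^'n" where v: "\<And>i j. (bform A (v i) (v j) = 0) \<longleftrightarrow> i \<noteq> j"
    using orthogonal_family_exists[OF assms, of UNIV] by auto
  define a where "a i = bform A (v i) (v i)" for i
  have a0: "a i \<noteq> 0" for i using v by (simp add: a_def)
  define C where "C = (\<chi> i j. v j $ i)"
  \<comment> \<open>Orthogonality makes the inverse of \<open>C\<close> explicit: pairing with
    \<open>v k\<close> and dividing by \<open>a k\<close> extracts the \<open>k\<close>-th
    coordinate.\<close>
  define D where "D = (\<chi> k j. inverse (a k) * (\<Sum>i\<in>UNIV. A $ i $ j * v k $ i))"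
  define ap :: "'a^'n^'n \<Rightarrow> ('n \<Rightarrow> 'a poly) \<Rightarrow> 'n \<Rightarrow> 'a poly" where
    "ap M x i = (\<Sum>j\<in>UNIV. smult (M $ i $ j) (x j))" for M x i
  have "D ** C = mat 1"
  proof -
    have "(D ** C) $ k $ l = inverse (a k) * bform A (v k) (v l)" for k l
      unfolding matrix_matrix_mult_def C_def D_def bform_def
      by (subst sum.swap) (simp add: sum_distrib_left sum_distrib_right mult_ac)
    then show ?thesis using v a0 by (auto simp: vec_eq_iff mat_def a_def)
  qed
  moreover from this have "C ** D = mat 1" by (simp only: matrix_left_right_inverse[of C D])
  moreover have ap_mult: "ap M (ap N x) = ap (M ** N) x" for M N x
  proof
    fix i
    have "ap M (ap N x) i = (\<Sum>j\<in>UNIV. \<Sum>k\<in>UNIV. smult (M $ i $ j * N $ j $ k) (x k))"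
      by (simp add: ap_def smult_sum_right)
    also have "\<dots> = (\<Sum>k\<in>UNIV. \<Sum>j\<in>UNIV. smult (M $ i $ j * N $ j $ k) (x k))" by (rule sum.swap)
    also have "\<dots> = ap (M ** N) x i" by (simp add: ap_def matrix_matrix_mult_def smult_sum)
    finally show "ap M (ap N x) i = ap (M ** N) x i" .
  qed
  moreover have "ap (mat 1) x = x" for x
  proof
    fix i
    have "ap (mat 1) x i = (\<Sum>j\<in>UNIV. if i = j then x j else 0)"
      unfolding ap_def by (intro sum.cong refl) (auto simp: mat_def)
    then show "ap (mat 1) x i = x i" by simp
  qed
  ultimately have inv: "ap C (ap D x) = x" "ap D (ap C x) = x" for x by (simp_all only:)
  have deg: "range (ap M x) \<subseteq> polys_lt d" if "range x \<subseteq> polys_lt d" for M x d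
    using that by (auto simp: ap_def intro!: polys_lt_sum polys_lt_smult)
  have "qf_eval A (\<chi> i. ap C x i) = (\<Sum>i\<in>UNIV. smult (a i) (x i ^ 2))" for x
  proof -
    have "qf_eval A (\<chi> i. ap C x i) =
        (\<Sum>i\<in>UNIV. \<Sum>j\<in>UNIV. \<Sum>k\<in>UNIV. \<Sum>l\<in>UNIV. smult (A $ i $ j * v k $ i * v l $ j) (x k * x l))"
      by (simp add: qf_eval_def ap_def C_def sum_product smult_sum_right mult_ac)
    \<comment> \<open>The swaps move the sums over \<open>k\<close> and \<open>l\<close> outward
      until the inner double sum is \<open>bform A (v k) (v l)\<close>.\<close>
    also have "\<dots> = (\<Sum>i\<in>UNIV. \<Sum>k\<in>UNIV. \<Sum>j\<in>UNIV. \<Sum>l\<in>UNIV. smult (A $ i $ j * v k $ i * v l $ j) (x k * x l))"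
      by (rule sum.cong[OF refl], rule sum.swap)
    also have "\<dots> = (\<Sum>k\<in>UNIV. \<Sum>i\<in>UNIV. \<Sum>l\<in>UNIV. \<Sum>j\<in>UNIV. smult (A $ i $ j * v k $ i * v l $ j) (x k * x l))"
      by (subst sum.swap) (rule sum.cong[OF refl], rule sum.cong[OF refl], rule sum.swap)
    also have "\<dots> = (\<Sum>k\<in>UNIV. \<Sum>l\<in>UNIV. \<Sum>i\<in>UNIV. \<Sum>j\<in>UNIV. smult (A $ i $ j * v k $ i * v l $ j) (x k * x l))"
      by (rule sum.cong[OF refl], rule sum.swap)
    also have "\<dots> = (\<Sum>k\<in>UNIV. \<Sum>l\<in>UNIV. smult (bform A (v k) (v l)) (x k * x l))"
      by (simp add: bform_def smult_sum)
    also have "\<dots> = (\<Sum>k\<in>UNIV. \<Sum>l\<in>UNIV. if k = l then smult (a k) (x k * x k) else 0)"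
      using v by (intro sum.cong refl) (auto simp: a_def)
    finally show ?thesis by (simp add: power2_eq_square)
  qed
  then have "form_equiv (\<lambda>x. qf_eval A (\<chi> i. x i)) (\<lambda>x. \<Sum>i\<in>UNIV. smult (a i) (x i ^ 2))"
    unfolding form_equiv_def using inv deg by (intro exI[of _ "ap C"] exI[of _ "ap D"]) simp
  with a0 show ?thesis by blast
qed

text \<open>The stage of the reduction with \<open>s\<close> hyperbolic planes:
  \<open>\<alpha>\<close> and \<open>\<beta>\<close> enumerate their coordinates, and the variables
  in \<open>S\<close> are still diagonal.\<close>

definition split_form ::
    "(nat \<Rightarrow> 'n) \<Rightarrow> (nat \<Rightarrow> 'n) \<Rightarrow> nat \<Rightarrow> 'n set \<Rightarrow> ('n \<Rightarrow> 'a::field) \<Rightarrow> ('n \<Rightarrow> 'a poly) \<Rightarrow> 'a poly" where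
  "split_form \<alpha> \<beta> s S a x = (\<Sum>l<s. x (\<alpha> l) * x (\<beta> l)) + (\<Sum>p\<in>S. smult (a p) (x p ^ 2))"

text \<open>For the form \<open>A x^2 + B y^2\<close> the vectors \<open>(r, t)\<close> and
  \<open>(- B * t, A * r)\<close> are orthogonal, with values \<open>- C\<close> and
  \<open>- A * B * C\<close>. The term \<open>- C * X ^ 2\<close> then combines with
  \<open>C * Z ^ 2\<close> to \<open>C * (Z - X) * (Z + X)\<close>.\<close>

lemma ternary_identity:
  fixes A B C :: "'r::comm_ring_1"
  assumes "A * r ^ 2 + B * t ^ 2 = - C" and "C * (Z - X) = xi" "Z + X = xj"
  shows "A * (r * X - B * t * s) ^ 2 + B * (t * X + A * r * s) ^ 2 + C * Z ^ 2 = xi * xj - A * B * C * s ^ 2"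
proof -
  have "A * (r * X - B * t * s) ^ 2 + B * (t * X + A * r * s) ^ 2 =
      (A * r ^ 2 + B * t ^ 2) * (X ^ 2 + A * B * s ^ 2)"
    by (simp add: algebra_simps power2_eq_square)
  moreover have "xi * xj = C * Z ^ 2 - C * X ^ 2"
    unfolding assms(2,3)[symmetric] by (simp add: algebra_simps power2_eq_square)
  ultimately show ?thesis unfolding assms(1) by (simp add: algebra_simps)
qed

text \<open>
  Over a finite field \<open>\<langle>a, b\<rangle>\<close> represents \<open>-c\<close>, so \<open>\<langle>a, b, c\<rangle>\<close> is \<open>\<langle>-c, -abc, c\<rangle>\<close>,
  whose outer terms form a hyperbolic plane.
\<close>

lemma form_equiv_split_step:
  fixes a :: "'n::finite \<Rightarrow> 'a::{finite,field}"
  assumes ijk: "i \<in> S" "j \<in> S" "k \<in> S" "i \<noteq> j" "i \<noteq> k" "j \<noteq> k"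
    and a0: "a i \<noteq> 0" "a j \<noteq> 0" "a k \<noteq> 0" and two: "(2::'a) \<noteq> 0"
    and out: "\<And>l. l < s \<Longrightarrow> \<alpha> l \<notin> S \<and> \<beta> l \<notin> S"
  shows "form_equiv (split_form \<alpha> \<beta> s S a)
    (split_form (\<alpha>(s := i)) (\<beta>(s := j)) (Suc s) (S - {i, j}) (a(k := - (a i * a j * a k))))"
proof -
  obtain r t where rt: "a i * r ^ 2 + a j * t ^ 2 = - a k"
    using binary_form_universal[OF a0(1,2)] by metis
  define h where "h = inverse (2 :: 'a)"
  define c where "c = inverse (a k)"
  \<comment> \<open>\<open>X\<close> and \<open>Z\<close> solve \<open>a k * (Z - X) = x i\<close>
    and \<open>Z + X = x j\<close>, as required by \<open>ternary_identity\<close>, in which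
    \<open>x k\<close> takes the place of \<open>s\<close>.\<close>
  define X where "X x = smult h (x j - smult c (x i))" for x :: "'n \<Rightarrow> 'a poly"
  define Z where "Z x = smult h (x j + smult c (x i))" for x :: "'n \<Rightarrow> 'a poly"
  define T where "T x = x(i := smult r (X x) - smult (a j * t) (x k), j := smult t (X x) + smult (a i * r) (x k), k := Z x)" for x
  \<comment> \<open>\<open>X'\<close> and \<open>s'\<close> are the coordinates of
    \<open>(x i, x j)\<close> along \<open>(r, t)\<close> and \<open>(- a j * t, a i * r)\<close>,
    found by pairing with these vectors and dividing by their values \<open>- a k\<close> and
    \<open>- a i * a j * a k\<close>.\<close>
  define X' where "X' x = smult (- c) (smult (a i * r) (x i) + smult (a j * t) (x j))" for x :: "'n \<Rightarrow> 'a poly"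
  define s' where "s' x = smult (- c) (smult r (x j) - smult t (x i))" for x :: "'n \<Rightarrow> 'a poly"
  define T' where "T' x = x(i := smult (a k) (x k - X' x), j := x k + X' x, k := s' x)" for x
  have h: "h + h = 1" using two by (simp add: h_def field_simps)
  have c: "c * a k = 1" "a k * c = 1" using a0 by (simp_all add: c_def)
  have rtc: "c * (a i * r ^ 2 + a j * t ^ 2) = - 1" using c by (simp add: rt)
  have half: "h * u + h * u = u" for u using h by (metis distrib_right mult_1)
  have ZX: "smult (a k) (Z x - X x) = x i" "Z x + X x = x j" for x
  proof -
    have "a k * (h * (u + c * v) - h * (u - c * v)) = v" for u v
    proof -
      have "a k * (h * (u + c * v) - h * (u - c * v)) = (h + h) * (a k * c) * v" by (simp add: algebra_simps)
      then show ?thesis by (simp add: h c)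
    qed
    then show "smult (a k) (Z x - X x) = x i" by (simp add: Z_def X_def poly_eq_iff)
    have "h * (u + c * v) + h * (u - c * v) = u" for u v
    proof -
      have "h * (u + c * v) + h * (u - c * v) = (h + h) * u" by (simp add: algebra_simps)
      then show ?thesis by (simp add: h)
    qed
    then show "Z x + X x = x j" by (simp add: Z_def X_def poly_eq_iff)
  qed
  have inv1: "T (T' x) = x" for x
  proof -
    have dbl: "smult h (p + p) = p" for p
      by (simp only: poly_eq_iff coeff_smult coeff_add distrib_left half simp_thms)
    have X': "X (T' x) = smult h (x k + X' x - (x k - X' x))" "Z (T' x) = smult h (x k + X' x + (x k - X' x))"
      using ijk by (simp_all add: X_def Z_def T'_def c)
    have XX: "X (T' x) = X' x" "Z (T' x) = x k"
    proof -
      have "x k + X' x - (x k - X' x) = X' x + X' x" "x k + X' x + (x k - X' x) = x k + x k" by simp_all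
      then show "X (T' x) = X' x" "Z (T' x) = x k" unfolding X' by (simp_all only: dbl)
    qed
    have Tk: "T' x k = s' x" using ijk by (simp add: T'_def)
    have "r * (- c * (a i * r * u + a j * t * v)) - a j * t * (- c * (r * v - t * u)) = u" for u v
    proof -
      have "r * (- c * (a i * r * u + a j * t * v)) - a j * t * (- c * (r * v - t * u)) =
          - (c * (a i * r ^ 2 + a j * t ^ 2)) * u" by (simp add: algebra_simps power2_eq_square)
      then show ?thesis by (simp add: rtc)
    qed
    then have 1: "smult r (X' x) - smult (a j * t) (s' x) = x i"
      by (simp only: X'_def s'_def poly_eq_iff coeff_diff coeff_add coeff_smult) simp
    have "t * (- c * (a i * r * u + a j * t * v)) + a i * r * (- c * (r * v - t * u)) = v" for u v
    proof -
      have "t * (- c * (a i * r * u + a j * t * v)) + a i * r * (- c * (r * v - t * u)) =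
          - (c * (a i * r ^ 2 + a j * t ^ 2)) * v" by (simp add: algebra_simps power2_eq_square)
      then show ?thesis by (simp add: rtc)
    qed
    then have 2: "smult t (X' x) + smult (a i * r) (s' x) = x j"
      by (simp only: X'_def s'_def poly_eq_iff coeff_diff coeff_add coeff_smult) simp
    show ?thesis unfolding T_def XX Tk 1 2 using ijk by (auto simp: T'_def fun_eq_iff)
  qed
  have inv2: "T' (T x) = x" for x
  proof -
    have "- c * (a i * r * (r * u - a j * t * v) + a j * t * (t * u + a i * r * v)) = u" for u v
    proof -
      have "- c * (a i * r * (r * u - a j * t * v) + a j * t * (t * u + a i * r * v)) =
          - (c * (a i * r ^ 2 + a j * t ^ 2)) * u" by (simp add: algebra_simps power2_eq_square)
      then show ?thesis by (simp add: rtc)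
    qed
    then have "smult (- c) (smult (a i * r) (smult r (X x) - smult (a j * t) (x k)) +
        smult (a j * t) (smult t (X x) + smult (a i * r) (x k))) = X x"
      by (simp only: poly_eq_iff coeff_diff coeff_add coeff_smult) simp
    then have XX: "X' (T x) = X x" using ijk by (simp add: X'_def T_def)
    have "- c * (r * (t * u + a i * r * v) - t * (r * u - a j * t * v)) = v" for u v
    proof -
      have "- c * (r * (t * u + a i * r * v) - t * (r * u - a j * t * v)) =
          - (c * (a i * r ^ 2 + a j * t ^ 2)) * v" by (simp add: algebra_simps power2_eq_square)
      then show ?thesis by (simp add: rtc)
    qed
    then have "smult (- c) (smult r (smult t (X x) + smult (a i * r) (x k)) -
        smult t (smult r (X x) - smult (a j * t) (x k))) = x k"
      by (simp only: poly_eq_iff coeff_diff coeff_add coeff_smult) simp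
    then have ss: "s' (T x) = x k" using ijk by (simp add: s'_def T_def)
    have Tk: "T x k = Z x" using ijk by (simp add: T_def)
    show ?thesis unfolding T'_def[of "T x"] XX ss Tk ZX using ijk by (auto simp: T_def fun_eq_iff)
  qed
  have deg: "range (T x) \<subseteq> polys_lt d \<and> range (T' x) \<subseteq> polys_lt d" if "range x \<subseteq> polys_lt d" for x d
  proof -
    have x: "x p \<in> polys_lt d" for p using that by blast
    have "X x \<in> polys_lt d" "Z x \<in> polys_lt d" "X' x \<in> polys_lt d" "s' x \<in> polys_lt d"
      unfolding X_def Z_def X'_def s'_def
      by (intro polys_lt_smult polys_lt_add polys_lt_diff x)+
    then show ?thesis
      by (auto simp: T_def T'_def x intro!: polys_lt_smult polys_lt_add polys_lt_diff)
  qed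
  have "split_form \<alpha> \<beta> s S a (T x) = split_form (\<alpha>(s := i)) (\<beta>(s := j)) (Suc s) (S - {i, j})
      (a(k := - (a i * a j * a k))) x" for x
  proof -
    let ?R = "S - {i, j, k}"
    have S: "S = insert i (insert j (insert k ?R))" "S - {i, j} = insert k ?R" using ijk by auto
    have Tv: "T x i = smult r (X x) - smult (a j * t) (x k)" "T x j = smult t (X x) + smult (a i * r) (x k)"
      "T x k = Z x" using ijk by (simp_all add: T_def)
    have To: "T x p = x p" if "p \<noteq> i" "p \<noteq> j" "p \<noteq> k" for p using that by (simp add: T_def)
    have "[:a i:] * ([:r:] * X x - [:a j:] * [:t:] * x k) ^ 2 + [:a j:] * ([:t:] * X x + [:a i:] * [:r:] * x k) ^ 2
        + [:a k:] * Z x ^ 2 = x i * x j - [:a i:] * [:a j:] * [:a k:] * x k ^ 2"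
    proof (rule ternary_identity)
      show "[:a i:] * [:r:] ^ 2 + [:a j:] * [:t:] ^ 2 = - [:a k:]"
        using rt by (simp add: power2_eq_square mult_ac)
    qed (use ZX in simp_all)
    then have tern: "smult (a i) (T x i ^ 2) + smult (a j) (T x j ^ 2) + smult (a k) (T x k ^ 2) =
        x i * x j + smult (- (a i * a j * a k)) (x k ^ 2)"
      unfolding Tv by (simp add: mult_ac)
    have "(\<Sum>l<s. T x (\<alpha> l) * T x (\<beta> l)) = (\<Sum>l<s. x (\<alpha> l) * x (\<beta> l))"
    proof (intro sum.cong refl)
      fix l assume "l \<in> {..<s}"
      then have "\<alpha> l \<notin> S" "\<beta> l \<notin> S" using out by auto
      then have "T x (\<alpha> l) = x (\<alpha> l)" "T x (\<beta> l) = x (\<beta> l)" using ijk by (auto intro!: To)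
      then show "T x (\<alpha> l) * T x (\<beta> l) = x (\<alpha> l) * x (\<beta> l)" by simp
    qed
    moreover have "(\<Sum>p\<in>S. smult (a p) (T x p ^ 2)) =
        smult (a i) (T x i ^ 2) + smult (a j) (T x j ^ 2) + smult (a k) (T x k ^ 2)
        + (\<Sum>p\<in>?R. smult (a p) (x p ^ 2))"
    proof -
      have "(\<Sum>p\<in>?R. smult (a p) (T x p ^ 2)) = (\<Sum>p\<in>?R. smult (a p) (x p ^ 2))"
        using To by (intro sum.cong refl) auto
      then show ?thesis by (subst S(1)) (use ijk in \<open>simp add: add_ac\<close>)
    qed
    moreover have "(\<Sum>p\<in>S - {i, j}. smult ((a(k := - (a i * a j * a k))) p) (x p ^ 2)) =
        smult (- (a i * a j * a k)) (x k ^ 2) + (\<Sum>p\<in>?R. smult (a p) (x p ^ 2))"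
      by (subst S(2)) (auto intro!: sum.cong)
    ultimately show ?thesis
      unfolding split_form_def tern by (simp add: add_ac)
  qed
  then show ?thesis
    unfolding form_equiv_def using inv1 inv2 deg by (intro exI[of _ T] exI[of _ T']) simp
qed

text \<open>Each step trades two diagonal variables for a hyperbolic plane and uses a third one to
  absorb the discriminant; while \<open>s < m\<close>, at least three are left.\<close>

lemma form_equiv_split:
  fixes a :: "'n::finite \<Rightarrow> 'a::{finite,field}"
  assumes "\<And>i. a i \<noteq> 0" and two: "(2::'a) \<noteq> 0" and "CARD('n) = 2 * m + 1" and "s \<le> m"
  shows "\<exists>\<alpha> \<beta> S b. form_equiv (\<lambda>x. \<Sum>i\<in>UNIV. smult (a i) (x i ^ 2)) (split_form \<alpha> \<beta> s S b) \<and>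
     (\<forall>p\<in>S. b p \<noteq> 0) \<and> inj_on \<alpha> {..<s} \<and> inj_on \<beta> {..<s} \<and> \<alpha> ` {..<s} \<inter> \<beta> ` {..<s} = {} \<and>
     S = - (\<alpha> ` {..<s} \<union> \<beta> ` {..<s}) \<and> card S = 2 * (m - s) + 1"
  using \<open>s \<le> m\<close>
proof (induction s)
  case 0
  have "form_equiv (\<lambda>x. \<Sum>i\<in>UNIV. smult (a i) (x i ^ 2)) (split_form \<alpha> \<beta> 0 UNIV a)" for \<alpha> \<beta>
    by (simp add: split_form_def[abs_def] form_equiv_refl)
  \<comment> \<open>With no planes split off yet the enumerations are arbitrary.\<close>
  then show ?case using assms by (intro exI[of _ "\<lambda>_. undefined"] exI[of _ UNIV] exI[of _ a]) simp
next
  case (Suc s)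
  then obtain \<alpha> \<beta> :: "nat \<Rightarrow> 'n" and S b where
    1: "form_equiv (\<lambda>x. \<Sum>i\<in>UNIV. smult (a i) (x i ^ 2)) (split_form \<alpha> \<beta> s S b)"
      "\<forall>p\<in>S. b p \<noteq> 0" "inj_on \<alpha> {..<s}" "inj_on \<beta> {..<s}" "\<alpha> ` {..<s} \<inter> \<beta> ` {..<s} = {}"
      "S = - (\<alpha> ` {..<s} \<union> \<beta> ` {..<s})" "card S = 2 * (m - s) + 1"
    by auto
  have "card S \<ge> 3" using 1(7) Suc.prems by linarith
  from obtain_subset_with_card_n[OF this] obtain U where "U \<subseteq> S" "card U = 3" by blast
  then obtain i j k where ijk: "i \<in> S" "j \<in> S" "k \<in> S" "i \<noteq> j" "i \<noteq> k" "j \<noteq> k"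
    by (auto simp: card_3_iff)
  let ?\<alpha> = "\<alpha>(s := i)" and ?\<beta> = "\<beta>(s := j)" and ?b = "b(k := - (b i * b j * b k))"
  have im: "?\<alpha> ` {..<Suc s} = insert i (\<alpha> ` {..<s})" "?\<beta> ` {..<Suc s} = insert j (\<beta> ` {..<s})"
    by (auto simp: image_iff less_Suc_eq)
  have out: "\<alpha> l \<notin> S \<and> \<beta> l \<notin> S" if "l < s" for l using 1(6) that by auto
  have "form_equiv (split_form \<alpha> \<beta> s S b) (split_form ?\<alpha> ?\<beta> (Suc s) (S - {i, j}) ?b)"
    by (rule form_equiv_split_step) (use ijk 1(2) two out in auto)
  then have "form_equiv (\<lambda>x. \<Sum>i\<in>UNIV. smult (a i) (x i ^ 2)) (split_form ?\<alpha> ?\<beta> (Suc s) (S - {i, j}) ?b)"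
    using form_equiv_trans[OF 1(1)] by blast
  moreover have "\<forall>p\<in>S - {i, j}. ?b p \<noteq> 0" using 1(2) ijk by auto
  moreover have "inj_on ?\<alpha> {..<Suc s}" "inj_on ?\<beta> {..<Suc s}"
  proof -
    have "i \<notin> \<alpha> ` {..<s}" "j \<notin> \<beta> ` {..<s}" using 1(6) ijk by blast+
    then show "inj_on ?\<alpha> {..<Suc s}" "inj_on ?\<beta> {..<Suc s}"
      using inj_on_fun_updI[OF 1(3)] inj_on_fun_updI[OF 1(4)]
      by (auto simp: lessThan_Suc inj_on_insert image_iff)
  qed
  moreover have "?\<alpha> ` {..<Suc s} \<inter> ?\<beta> ` {..<Suc s} = {}" unfolding im using 1(5,6) ijk by blast
  moreover have "S - {i, j} = - (?\<alpha> ` {..<Suc s} \<union> ?\<beta> ` {..<Suc s})" unfolding im using 1(6) by blast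
  moreover have "card (S - {i, j}) = 2 * (m - Suc s) + 1"
    using ijk 1(7) Suc.prems by (simp add: card_Diff_subset)
  ultimately show ?case
    by (intro exI[of _ ?\<alpha>] exI[of _ ?\<beta>] exI[of _ "S - {i, j}"] exI[of _ ?b] conjI)
qed

text \<open>A relabelling: the images of \<open>\<alpha>\<close> and \<open>\<beta>\<close> together
  with \<open>c\<close> partition the index type.\<close>

lemma card_zeros_split_form:
  fixes b :: "'n::finite \<Rightarrow> 'a::field_gcd"
  assumes inj: "inj_on \<alpha> {..<m}" "inj_on \<beta> {..<m}" and disj: "\<alpha> ` {..<m} \<inter> \<beta> ` {..<m} = {}"
    and c: "{c} = - (\<alpha> ` {..<m} \<union> \<beta> ` {..<m})"
  shows "card {x. range x \<subseteq> polys_lt d \<and> split_form \<alpha> \<beta> m {c} b x = 0} = card (quadric_vectors (b c) {..<m} d)"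
proof -
  let ?f = "\<lambda>x. (\<lambda>l\<in>{..<m}. x (\<alpha> l), \<lambda>l\<in>{..<m}. x (\<beta> l), x c) :: (nat \<Rightarrow> 'a poly) \<times> (nat \<Rightarrow> 'a poly) \<times> 'a poly"
  define g where "g = (\<lambda>(x, y, z) p. if p = c then z else if p \<in> \<alpha> ` {..<m}
      then x (inv_into {..<m} \<alpha> p) else y (inv_into {..<m} \<beta> p) :: 'a poly)"
  have cases: "p = c \<or> (\<exists>l<m. p = \<alpha> l) \<or> (\<exists>l<m. p = \<beta> l)" for p using c by blast
  have ne: "\<alpha> l \<noteq> c" "\<beta> l \<noteq> c" "\<beta> l \<notin> \<alpha> ` {..<m}" if "l < m" for l using c disj that by auto
  have gv: "g (x, y, z) c = z" "l < m \<Longrightarrow> g (x, y, z) (\<alpha> l) = x l" "l < m \<Longrightarrow> g (x, y, z) (\<beta> l) = y l" for x y z l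
    using ne inj by (auto simp: g_def inv_into_f_f)
  have "bij_betw ?f {x. range x \<subseteq> polys_lt d \<and> split_form \<alpha> \<beta> m {c} b x = 0} (quadric_vectors (b c) {..<m} d)"
  proof (rule bij_betwI[where g = g])
    show "?f \<in> {x. range x \<subseteq> polys_lt d \<and> split_form \<alpha> \<beta> m {c} b x = 0} \<rightarrow> quadric_vectors (b c) {..<m} d"
      by (auto simp: quadric_vectors_def split_form_def PiE_iff image_subset_iff)
    show "g \<in> quadric_vectors (b c) {..<m} d \<rightarrow> {x. range x \<subseteq> polys_lt d \<and> split_form \<alpha> \<beta> m {c} b x = 0}"
    proof
      fix t assume "t \<in> quadric_vectors (b c) {..<m} d"
      then obtain x y z where t: "t = (x, y, z)" and x: "x \<in> {..<m} \<rightarrow>\<^sub>E polys_lt d"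
        and y: "y \<in> {..<m} \<rightarrow>\<^sub>E polys_lt d" and z: "z \<in> polys_lt d"
        and f: "(\<Sum>i<m. x i * y i) + smult (b c) (z ^ 2) = 0"
        by (auto simp: quadric_vectors_def)
      have "g t p \<in> polys_lt d" for p
        using cases[of p] gv x y z by (auto simp: t)
      then show "g t \<in> {x. range x \<subseteq> polys_lt d \<and> split_form \<alpha> \<beta> m {c} b x = 0}"
        using f by (auto simp: split_form_def t gv)
    qed
  next
    fix x assume "x \<in> {x. range x \<subseteq> polys_lt d \<and> split_form \<alpha> \<beta> m {c} b x = 0}"
    show "g (?f x) = x"
    proof
      fix p show "g (?f x) p = x p" using cases[of p] by (auto simp: gv)
    qed
  next
    fix t assume "t \<in> quadric_vectors (b c) {..<m} d"
    then obtain x y z where "t = (x, y, z)" "x \<in> extensional {..<m}" "y \<in> extensional {..<m}"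
      by (auto simp: quadric_vectors_def PiE_def)
    then show "?f (g t) = t" by (auto simp: gv fun_eq_iff extensional_def)
  qed
  then show ?thesis by (rule bij_betw_same_card)
qed

definition isotropic_vectors :: "'a::field_gcd^'n^'n \<Rightarrow> nat \<Rightarrow> ('a poly^'n) set" where
  "isotropic_vectors A d = {x. (\<forall>i. x $ i \<in> polys_lt d) \<and> qf_eval A x = 0}"

text \<open>Diagonalize and split off hyperbolic planes until one diagonal variable is left. Its
  coefficient \<open>c\<close> stays unspecified, the later counts being the same for every nonzero
  value.\<close>

lemma card_isotropic_vectors_eq:
  fixes A :: "'a::{finite,field_gcd}^'n^'n"
  assumes "det A \<noteq> 0" "transpose A = A" "(2::'a) \<noteq> 0" "CARD('n) = 2 * m + 1"
  obtains c :: 'a where "c \<noteq> 0" "\<And>d. card (isotropic_vectors A d) = card (quadric_vectors c {..<m} d)"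
proof -
  obtain a :: "'n \<Rightarrow> 'a" where a0: "\<And>i. a i \<noteq> 0" and
    e1: "form_equiv (\<lambda>x. qf_eval A (\<chi> i. x i)) (\<lambda>x. \<Sum>i\<in>UNIV. smult (a i) (x i ^ 2))"
    using form_equiv_diagonal[OF assms(1-3)] by blast
  obtain \<alpha> \<beta> :: "nat \<Rightarrow> 'n" and S b where
    2: "form_equiv (\<lambda>x. \<Sum>i\<in>UNIV. smult (a i) (x i ^ 2)) (split_form \<alpha> \<beta> m S b)"
      "\<forall>p\<in>S. b p \<noteq> 0" "inj_on \<alpha> {..<m}" "inj_on \<beta> {..<m}" "\<alpha> ` {..<m} \<inter> \<beta> ` {..<m} = {}"
      "S = - (\<alpha> ` {..<m} \<union> \<beta> ` {..<m})" "card S = 2 * (m - m) + 1"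
    using form_equiv_split[where a = a, OF a0 assms(3,4) order_refl] by (elim exE conjE) (rule that)
  then obtain c where S: "S = {c}" by (auto simp: card_1_singleton_iff)
  have "card (isotropic_vectors A d) = card (quadric_vectors (b c) {..<m} d)" for d
  proof -
    have "bij_betw (\<lambda>x. \<chi> i. x i) {x. range x \<subseteq> polys_lt d \<and> qf_eval A (\<chi> i. x i) = 0} (isotropic_vectors A d)"
      by (rule bij_betwI[where g = "\<lambda>v i. v $ i"]) (auto simp: isotropic_vectors_def)
    then have "card (isotropic_vectors A d) = card {x. range x \<subseteq> polys_lt d \<and> qf_eval A (\<chi> i. x i) = 0}"
      by (rule bij_betw_same_card[symmetric])
    also have "\<dots> = card {x. range x \<subseteq> polys_lt d \<and> split_form \<alpha> \<beta> m {c} b x = 0}"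
      using card_zeros_form_equiv[OF form_equiv_trans[OF e1 2(1)], of d] by (simp add: S)
    also have "\<dots> = card (quadric_vectors (b c) {..<m} d)"
      using 2 S by (intro card_zeros_split_form) auto
    finally show ?thesis .
  qed
  moreover have "b c \<noteq> 0" using 2(2) S by simp
  ultimately show ?thesis by (intro that[of "b c"])
qed

section \<open>Dividing out the content\<close>

lemma finite_isotropic_vectors:
  fixes A :: "'a::{finite,field_gcd}^'n^'n"
  shows "finite (isotropic_vectors A d)"
proof -
  have "finite ((UNIV :: 'n set) \<rightarrow>\<^sub>E (polys_lt d :: 'a poly set))" by (intro finite_PiE) auto
  then have "finite ((\<lambda>f. \<chi> i. f i) ` ((UNIV :: 'n set) \<rightarrow>\<^sub>E (polys_lt d :: 'a poly set)))" by blast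
  moreover have "isotropic_vectors A d \<subseteq> (\<lambda>f. \<chi> i. f i) ` (UNIV \<rightarrow>\<^sub>E polys_lt d)"
  proof
    fix x assume "x \<in> isotropic_vectors A d"
    then show "x \<in> (\<lambda>f. \<chi> i. f i) ` (UNIV \<rightarrow>\<^sub>E polys_lt d)"
      by (intro image_eqI[of _ _ "\<lambda>i. x $ i"]) (auto simp: isotropic_vectors_def)
  qed
  ultimately show ?thesis using finite_subset by blast
qed

lemma isotropic_vectors_mono: "d \<le> e \<Longrightarrow> isotropic_vectors A d \<subseteq> isotropic_vectors A e"
  using polys_lt_mono by (fastforce simp: isotropic_vectors_def)

text \<open>\<open>W d\<close> consists of the nonzero zeros of maximal degree exactly
  \<open>d\<close>. Scaling by \<open>h\<close> multiplies the form by \<open>h ^ 2\<close> and so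
  respects isotropy, and content grouping applies with constant weight.\<close>

lemma card_isotropic_vectors_diff_by_content:
  fixes A :: "'a::{finite,field_gcd}^'n^'n"
  defines "W \<equiv> \<lambda>d. isotropic_vectors A (Suc d) - isotropic_vectors A d"
  shows "card (W P) = (\<Sum>j\<le>P. CARD('a) ^ j * card {x \<in> W (P - j). Gcd (range (\<lambda>i. x $ i)) = 1})"
proof -
  define cont where "cont x = Gcd (range (\<lambda>i. x $ i))" for x :: "'a poly^'n"
  define sc where "sc h x = (\<chi> i. h * x $ i)" for h :: "'a poly" and x :: "'a poly^'n"
  have qf: "qf_eval A (sc h x) = h ^ 2 * qf_eval A x" for h x
    by (simp add: qf_eval_def sc_def sum_distrib_left power2_eq_square mult_ac)
  have W: "sc h x \<in> W (j + d) \<longleftrightarrow> x \<in> W d" if h: "h \<in> monics j" for h x j d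
  proof -
    have "sc h x \<in> isotropic_vectors A (j + e) \<longleftrightarrow> x \<in> isotropic_vectors A e" for e
      using monicsD(1)[OF h] qf[of h x] polys_lt_mult_monic[OF h]
      by (simp add: isotropic_vectors_def) (simp add: sc_def)
    from this[of d] this[of "Suc d"] show ?thesis by (simp add: W_def)
  qed
  have "(\<Sum>v\<in>W P. 1) = (\<Sum>j\<le>P. (\<Sum>h\<in>(monics j :: 'a poly set). 1) * card {v \<in> W (P - j). cont v = 1})"
  proof (rule sum_by_content[where sc = sc])
    show "finite (W d)" for d by (simp add: W_def finite_isotropic_vectors)
  next
    fix h :: "'a poly" and j v d assume "h \<in> monics j" "v \<in> W d"
    then show "sc h v \<in> W (j + d)" using W by blast
  next
    fix h :: "'a poly" and j v d assume h: "h \<in> monics j"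
    have "range (\<lambda>i. sc h v $ i) = (*) h ` range (\<lambda>i. v $ i)" by (auto simp: sc_def)
    then show "cont (sc h v) = h * cont v" using h by (simp add: cont_def Gcd_mult_monic)
  next
    fix h :: "'a poly" and j v v' assume "h \<in> monics j" "sc h v = sc h v'"
    then show "v = v'" by (auto simp: sc_def vec_eq_iff dest: monicsD(1))
  next
    fix v d assume v: "v \<in> W d"
    let ?g = "cont v"
    obtain i where i: "v $ i \<in> polys_lt (Suc d)" "v $ i \<notin> polys_lt d"
      using v by (auto simp: W_def isotropic_vectors_def)
    have gv: "?g dvd v $ k" for k unfolding cont_def by (rule Gcd_dvd) simp
    have vi0: "v $ i \<noteq> 0" using i(2) by auto
    then have g0: "?g \<noteq> 0" using gv[of i] by auto
    have g: "?g \<in> monics (degree ?g)" using g0 by (intro monic_of_normalize) (simp_all add: cont_def)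
    have le: "degree ?g \<le> d"
      using dvd_imp_degree_le[OF gv vi0] i(1) by (simp add: polys_lt_Suc_iff)
    define v' where "v' = (\<chi> k. v $ k div ?g)"
    have vv: "v = sc ?g v'" using gv by (simp add: sc_def v'_def vec_eq_iff)
    have "v' \<in> W (d - degree ?g)"
      using W[OF g, of v' "d - degree ?g"] v vv le by simp
    then show "\<exists>j\<le>d. ?g \<in> monics j \<and> (\<exists>v'\<in>W (d - j). v = sc ?g v')"
      using g le vv by blast
  qed
  then show ?thesis by (simp add: cont_def card_monics)
qed

text \<open>The positive index matters: since \<open>degree 0 = 0\<close>, in degree zero the
  maximum would not separate the zero vector from the nonzero constant vectors.\<close>

lemma mor_vectors_eq:
  fixes A :: "'a::{finite,field_gcd}^'n^'n"
  shows "mor_vectors A (Suc p) =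
    {x \<in> isotropic_vectors A (Suc (Suc p)) - isotropic_vectors A (Suc p). Gcd (range (\<lambda>i. x $ i)) = 1}"
proof -
  have "Max (range (\<lambda>i. degree (x $ i))) = Suc p \<longleftrightarrow>
      (\<forall>i. x $ i \<in> polys_lt (Suc (Suc p))) \<and> \<not> (\<forall>i. x $ i \<in> polys_lt (Suc p))" for x :: "'a poly^'n"
    by (simp add: Max_eq_iff polys_lt_Suc_iff image_iff not_le) (metis Suc_leI lessI le_antisym)
  then show ?thesis by (auto simp: mor_vectors_def isotropic_vectors_def)
qed

text \<open>The strata \<open>W\<close> are the convolution of \<open>q ^ j\<close> with the
  primitive counts \<open>M\<close>, so \<open>M (Suc p)\<close> is \<open>W (Suc p)\<close> minus
  \<open>q\<close> times \<open>W p\<close> in cardinality. Each stratum is the number of nonzero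
  isotropic constants times a count with one hyperbolic pair fewer.\<close>

lemma card_mor_vectors:
  fixes A :: "'a::{finite,field_gcd}^'n^'n"
  assumes "odd CARD('a)" and "CARD('n) = 2 * Suc k + 1" and "transpose A = A" and "det A \<noteq> 0"
  defines "q \<equiv> real CARD('a)"
  shows "real (card (mor_vectors A (Suc p))) = (q ^ (2 * Suc k) - 1) *
    (q ^ ((2 * k + 1) * Suc p) - q ^ ((2 * k + 1) * p) - (if even p then (q - 1) * q ^ (Suc k * p) else 0))"
proof -
  define W where "W d = isotropic_vectors A (Suc d) - isotropic_vectors A d" for d
  define M where "M d = card {x \<in> W d. Gcd (range (\<lambda>i. x $ i)) = 1}" for d
  obtain c :: 'a where c0: "c \<noteq> 0"
    and c: "\<And>d. card (isotropic_vectors A d) = card (quadric_vectors c {..<Suc k} d)"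
    using card_isotropic_vectors_eq[OF assms(4,3) two_neq_zero_if_odd_card[OF assms(1)] assms(2)] by blast
  \<comment> \<open>Removing the pair with index \<open>0\<close> leaves \<open>k\<close> pairs,
    that is, \<open>n - 2 = 2 * k + 1\<close> variables modulo \<open>Q\<close>.\<close>
  let ?I = "{..<Suc k}" and ?K = "{..<Suc k} - {0}"
  define D where "D d = real (card (divisor_solutions c ?K d))" for d
  have K: "card ?K = k" by simp
  have W: "real (card (W d)) = (q ^ (2 * Suc k) - 1) * D d" for d
  proof -
    have "quadric_vectors c ?I d \<subseteq> quadric_vectors c ?I (Suc d)"
      using polys_lt_mono[of d "Suc d"] by (fastforce simp: quadric_vectors_def)
    then have "card (W d) = card (quadric_vectors c ?I (Suc d) - quadric_vectors c ?I d)"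
      using isotropic_vectors_mono[of d "Suc d" A]
      by (simp add: W_def card_Diff_subset finite_isotropic_vectors finite_quadric_vectors c)
    also have "\<dots> = (CARD('a) ^ (2 * Suc k) - 1) * card (divisor_solutions c ?K d)"
      using card_quadric_vectors_diff[of ?I 0 c d] card_quadric_consts[of ?I c] c0 by simp
    finally show ?thesis by (simp add: D_def q_def of_nat_diff)
  qed
  have sum: "card (W d) = (\<Sum>j\<le>d. CARD('a) ^ j * M (d - j))" for d
    unfolding W_def M_def by (rule card_isotropic_vectors_diff_by_content)
  have "card (W (Suc p)) = M (Suc p) + (\<Sum>j\<le>p. CARD('a) ^ Suc j * M (p - j))"
    unfolding sum[of "Suc p"] by (subst sum.atMost_Suc_shift) simp
  also have "(\<Sum>j\<le>p. CARD('a) ^ Suc j * M (p - j)) = CARD('a) * card (W p)"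
    unfolding sum[of p] by (simp add: sum_distrib_left mult_ac)
  finally have "real (card (W (Suc p))) = real (M (Suc p)) + q * real (card (W p))"
    by (simp add: q_def)
  then have "real (M (Suc p)) = (q ^ (2 * Suc k) - 1) * (D (Suc p) - q * D p)"
    unfolding W by (simp add: algebra_simps)
  also have "D (Suc p) - q * D p = q ^ ((2 * k + 1) * Suc p) - q ^ ((2 * k + 1) * p)
      - (if even p then (q - 1) * q ^ (Suc k * p) else 0)"
    using card_divisor_solutions_diff(1)[of ?K c p] c0 unfolding D_def q_def K by simp
  finally show ?thesis by (simp only: mor_vectors_eq M_def W_def)
qed

section \<open>Closed forms for the number of morphisms\<close>

theorem theorem1p3:
  fixes A :: "'a::{finite,field_gcd}^'n^'n" and P :: nat
  assumes "odd CARD('a)"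
    and "odd CARD('n)" and "CARD('n) \<ge> 3"
    and "transpose A = A" and "det A \<noteq> 0"
    and "P \<ge> 1"
  shows "(CARD('n) = 3 \<longrightarrow>
            num_mor A P = (if even P then (real CARD('a)^2 - 1) / real CARD('a) * real CARD('a) ^ P
                           else 0))
       \<and> (CARD('n) \<ge> 5 \<longrightarrow>
            num_mor A P =
              (if even P then
                 (real CARD('a)^(CARD('n)-1) - 1) * (real CARD('a)^(CARD('n)-2) - 1)
                   / (real CARD('a)^(CARD('n)-2) * (real CARD('a) - 1)) * real CARD('a) ^ (P*(CARD('n)-2))
               else
                 (real CARD('a)^(CARD('n)-1) - 1) * (real CARD('a)^(CARD('n)-2) - 1)
                   / (real CARD('a)^(CARD('n)-2) * (real CARD('a) - 1)) * real CARD('a) ^ (P*(CARD('n)-2))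
                 - (real CARD('a)^(CARD('n)-1) - 1) / real CARD('a) ^ ((CARD('n)-1) div 2)
                   * real CARD('a) ^ (((CARD('n)-1) div 2) * P)))"
proof -
  obtain m where "CARD('n) = 2 * m + 1" using assms(2) by (elim oddE)
  with assms(3) obtain k where n: "CARD('n) = 2 * Suc k + 1" by (cases m) auto
  obtain p where P: "P = Suc p" using assms(6) by (cases P) auto
  define q where "q = real CARD('a)"
  have "card {0, 1 :: 'a} \<le> CARD('a)" by (rule card_mono) auto
  then have q: "q > 1" by (simp add: q_def)
  \<comment> \<open>With \<open>n\<close> the number of variables, \<open>v\<close> is
    \<open>q ^ (n - 2)\<close> and \<open>T\<close> below is the number
    \<open>q ^ (n - 1) - 1\<close> of nonzero isotropic constant vectors.\<close>
  define v where "v = q ^ (2 * k + 1)"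
  define T where "T = q ^ (2 * Suc k) - 1"
  have v0: "v \<noteq> 0" using q by (simp add: v_def)
  have "num_mor A P = T * (v * v ^ p - v ^ p - (if even p then (q - 1) * q ^ (Suc k * p) else 0)) / (q - 1)"
  proof -
    have "q ^ ((2 * k + 1) * Suc p) = v * v ^ p" "q ^ ((2 * k + 1) * p) = v ^ p"
      by (simp_all only: v_def power_mult power_Suc)
    then show ?thesis
      using card_mor_vectors[OF assms(1) n assms(4,5), of p, folded q_def]
      by (simp only: num_mor_def P T_def q_def[symmetric])
  qed
  then have N: "num_mor A P = T * (v - 1) / (v * (q - 1)) * v ^ P - (if even P then 0 else T * q ^ (Suc k * p))"
  proof -
    have "T * (v * V - V - x) / (q - 1) = T * (v - 1) / (v * (q - 1)) * (v * V) - T * x / (q - 1)" for V x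
    proof -
      have "T * (v - 1) / (v * (q - 1)) * (v * V) = T * (v - 1) * V / (q - 1)" using v0 by simp
      then show ?thesis by (simp add: diff_divide_distrib[symmetric] algebra_simps)
    qed
    \<comment> \<open>The parity flips because \<open>P = Suc p\<close>, and the factor
      \<open>q - 1\<close> of the correction cancels against the scalars.\<close>
    moreover have "T * (if even p then (q - 1) * q ^ (Suc k * p) else 0) / (q - 1) =
        (if even P then 0 else T * q ^ (Suc k * p))"
      using q by (simp add: P)
    moreover have "v ^ P = v * v ^ p" by (simp add: P)
    ultimately show ?thesis using \<open>num_mor A P = _\<close> by (simp only:)
  qed
  have 1: "q ^ (CARD('n) - 1) - 1 = T" "q ^ (CARD('n) - 2) = v" "q ^ (P * (CARD('n) - 2)) = v ^ P"
    "q ^ ((CARD('n) - 1) div 2) = q ^ Suc k" "q ^ ((CARD('n) - 1) div 2 * P) = q ^ Suc k * q ^ (Suc k * p)"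
    unfolding n by (simp_all add: T_def v_def P power_mult[symmetric] power_add[symmetric] algebra_simps)
  have "num_mor A P = (if even P then (q ^ 2 - 1) / q * q ^ P else 0)" if "CARD('n) = 3"
  proof -
    \<comment> \<open>For three variables \<open>v = q\<close>, so the leading term is
      \<open>T / q * q ^ P\<close>; for odd \<open>P\<close> the correction \<open>T * q ^ p\<close>
      cancels it completely.\<close>
    have "k = 0" using that n by simp
    then have "v = q" "T = q ^ 2 - 1" by (simp_all add: v_def T_def power2_eq_square)
    then show ?thesis using N q \<open>k = 0\<close> by (simp add: P)
  qed
  moreover have "num_mor A P = (if even P then T * (v - 1) / (v * (q - 1)) * v ^ P
      else T * (v - 1) / (v * (q - 1)) * v ^ P - T / q ^ Suc k * (q ^ Suc k * q ^ (Suc k * p)))"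
    using N q by simp
  ultimately show ?thesis unfolding q_def[symmetric] 1 by blast
qed

end
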